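(* Let $\psi:[0,1]\to[0,\infty)$ be a non-negative, measurable function and let $\omega_1$ and $\omega_2$ be positive, continuous functions on $\mathbb{R}^+=[0,\infty)$. Assume that there exists a constant $C$ such that $$\int_0^1\omega_2(s/t)\,\frac{\psi(t)}{t}\,dt\le C\,\omega_1(s)\qquad\text{for every } s\in\mathbb{R}^+,$$ so that $U_\psi:L^1(\omega_1)\to L^1(\omega_2)$ is a bounded operator, and let $\overline{U}_\psi:M(\omega_1)\to M(\omega_2)$ be its extension. Then $\operatorname{ran}\overline{U}_\psi\subseteq L^1(\omega_2)\oplus\mathbb{C}\delta_0$.
   Context: $\mathbb{R}^+=[0,\infty)$ with Lebesgue measure. For a positive, continuous function $\omega$ on $\mathbb{R}^+$: - $L^1(\omega)$ is the Banach space of (classes of) complex-valued measurable functions $f$ on $\mathbb{R}^+$ with $\|f\|_{L^1(\omega)}=\int_0^\infty|f(t)|\omega(t)\,dt<\infty$. - $L^\infty(1/\omega)$ is the space of (classes of) measurable functions $h$ on $\mathbb{R}^+$ with $\|h\|_{L^\infty(1/\omega)}=\operatorname{ess\,sup}_{t\in\mathbb{R}^+}|h(t)|/\omega(t)<\infty$; it is identified with the dual of $L^1(\omega)$ via $\langle f,h\rangle=\int_0^\infty f(t)h(t)\,dt$. - $C_0(1/\omega)$ is the closed subspace of $L^\infty(1/\omega)$ of continuous functions $g$ on $\mathbb{R}^+$ such that $g/\omega$ vanishes at infinity. - $M(\omega)$ is the space of locally finite complex Borel measures $\mu$ on $\mathbb{R}^+$ with $\|\mu\|_{M(\omega)}=\int_{\mathbb{R}^+}\omega(t)\,d|\mu|(t)<\infty$;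 it is identified with the dual of $C_0(1/\omega)$ via $\langle g,\mu\rangle=\int_{\mathbb{R}^+}g\,d\mu$. (Locally finite complex means complex-valued and countably additive on the Borel subsets of each compact subset of $\mathbb{R}^+$.) - $L^1(\omega)$ is regarded as a closed subspace of $M(\omega)$ by identifying $f$ with the measure $f(t)\,dt$. - $\delta_0$ is the unit point mass at $0$. The generalized Hardy-Cesàro operator is $(U_\psi f)(x)=\int_0^1 f(tx)\psi(t)\,dt=\frac1x\int_0^x f(s)\psi(s/x)\,ds$. Under the displayed integral condition it is a bounded operator from $L^1(\omega_1)$ to $L^1(\omega_2)$, and its adjoint $U_\psi^*:L^\infty(1/\omega_2)\to L^\infty(1/\omega_1)$, given by $(U_\psi^*h)(x)=\int_0^1h(x/t)\frac{\psi(t)}{t}\,dt$ for almost all $x$, maps $C_0(1/\omega_2)$ into $C_0(1/\omega_1)$. Let $V_\psi:C_0(1/\omega_2)\to C_0(1/\omega_1)$ be the restriction of $U_\psi^*$. Then $\overline{U}_\psi=V_\psi^*:M(\omega_1)\to M(\omega_2)$, which is a bounded extension of $U_\psi$. *)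

theory Defs
  imports "HOL-Analysis.Analysis"
begin

text \<open>A function on \<open>[0,\<infinity>)\<close> is represented by a function on \<open>real\<close> whose values on the negative
  half-line are never used: every integral below is over a measure living on a subset of
  \<open>[0,\<infinity>)\<close>. Elements of \<open>L\<^sup>1(\<omega>)\<close> are represented by functions, not by classes.\<close>

definition weighted_L1 :: "(real \<Rightarrow> real) \<Rightarrow> (real \<Rightarrow> complex) set"
  where "weighted_L1 \<omega> =
    {f \<in> borel_measurable (lebesgue_on {0..}).
       (\<integral>\<^sup>+ t. ennreal (cmod (f t) * \<omega> t) \<partial>lebesgue_on {0..}) < \<infinity>}"

text \<open>The space \<open>C\<^sub>0(1/\<omega>)\<close>. Boundedness of \<open>g/\<omega>\<close> on \<open>[0,\<infinity>)\<close> is automatic for a positive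
  continuous weight.\<close>

definition weighted_C0 :: "(real \<Rightarrow> real) \<Rightarrow> (real \<Rightarrow> complex) set"
  where "weighted_C0 \<omega> =
    {g. continuous_on {0..} g \<and> ((\<lambda>t. g t / complex_of_real (\<omega> t)) \<longlongrightarrow> 0) at_top}"


subsection \<open>Locally finite complex Borel measures on the half-line\<close>

definition bounded_borel :: "real set set"
  where "bounded_borel = {A \<in> sets borel. A \<subseteq> {0..} \<and> bounded A}"

text \<open>A locally finite complex measure need not have a value on unbounded sets. Giving it the
  dummy value \<open>0\<close> there makes equality of measures coincide with equality of functions.\<close>

definition loc_finite_complex_measure :: "(real set \<Rightarrow> complex) \<Rightarrow> bool"
  where "loc_finite_complex_measure \<mu> \<longleftrightarrow>
    (\<forall>K. compact K \<and> K \<subseteq> {0..} \<longrightarrow>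
       (\<forall>A :: nat \<Rightarrow> real set. range A \<subseteq> {B \<in> sets borel. B \<subseteq> K} \<and> disjoint_family A \<longrightarrow>
          (\<lambda>n. \<mu> (A n)) sums \<mu> (\<Union>n. A n))) \<and>
    (\<forall>A. A \<notin> bounded_borel \<longrightarrow> \<mu> A = 0)"

text \<open>The total variation \<open>|\<mu>|\<close>, by countable Borel partitions. The pieces are taken bounded
  so that \<open>\<mu>\<close> is defined on them; this does not change the supremum. For \<open>\<mu>\<close> as above the
  set function is countably additive, so that \<open>measure_of\<close> does not degenerate; the same holds
  for \<open>upper_variation\<close> below.\<close>

definition total_variation :: "(real set \<Rightarrow> complex) \<Rightarrow> real measure"
  where "total_variation \<mu> =
    measure_of {0..} (sets (restrict_space borel {0..}))
      (\<lambda>A. SUP E \<in> {E :: nat \<Rightarrow> real set.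
                range E \<subseteq> bounded_borel \<and> disjoint_family E \<and> (\<Union>n. E n) = A}.
              \<Sum>n. ennreal (cmod (\<mu> (E n))))"

definition weighted_measures :: "(real \<Rightarrow> real) \<Rightarrow> (real set \<Rightarrow> complex) set"
  where "weighted_measures \<omega> =
    {\<mu>. loc_finite_complex_measure \<mu> \<and> (\<integral>\<^sup>+ t. ennreal (\<omega> t) \<partial>total_variation \<mu>) < \<infinity>}"

text \<open>The positive part \<open>\<nu>\<^sup>+(A) = sup {\<nu>(B) | B \<subseteq> A}\<close> of the Jordan decomposition of a real
  measure. The truncation of negative values by \<open>ennreal\<close> is harmless, as \<open>B = {}\<close> is allowed.
  The negative part of \<open>\<nu>\<close> is the positive part of \<open>-\<nu>\<close>.\<close>

definition upper_variation :: "(real set \<Rightarrow> real) \<Rightarrow> real measure"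
  where "upper_variation \<nu> =
    measure_of {0..} (sets (restrict_space borel {0..}))
      (\<lambda>A. SUP B \<in> {B \<in> bounded_borel. B \<subseteq> A}. ennreal (\<nu> B))"

definition signed_integral :: "(real \<Rightarrow> complex) \<Rightarrow> (real set \<Rightarrow> real) \<Rightarrow> complex"
  where "signed_integral g \<nu> =
    (\<integral>t. g t \<partial>upper_variation \<nu>) - (\<integral>t. g t \<partial>upper_variation (\<lambda>A. - \<nu> A))"

definition complex_measure_integral :: "(real \<Rightarrow> complex) \<Rightarrow> (real set \<Rightarrow> complex) \<Rightarrow> complex"
  where "complex_measure_integral g \<mu> =
    signed_integral g (\<lambda>A. Re (\<mu> A)) + \<i> * signed_integral g (\<lambda>A. Im (\<mu> A))"

definition lebesgue_density :: "(real \<Rightarrow> complex) \<Rightarrow> real set \<Rightarrow> complex"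
  where "lebesgue_density f A =
    (if A \<in> bounded_borel then \<integral>t. f t \<partial>lebesgue_on A else 0)"

definition delta0 :: "real set \<Rightarrow> complex"
  where "delta0 A = (if A \<in> bounded_borel \<and> 0 \<in> A then 1 else 0)"

definition L1_plus_delta0 :: "(real \<Rightarrow> real) \<Rightarrow> (real set \<Rightarrow> complex) set"
  where "L1_plus_delta0 \<omega> =
    {(\<lambda>A. lebesgue_density f A + c * delta0 A) | f c. f \<in> weighted_L1 \<omega>}"


subsection \<open>The extended Hardy-Cesaro operator\<close>

text \<open>The operator \<open>V\<^sub>\<psi>\<close>, i.e. the restriction of \<open>U\<^sub>\<psi>\<^sup>*\<close> to \<open>C\<^sub>0(1/\<omega>\<^sub>2)\<close>. On that space the
  formula, taken at every \<open>x\<close>, yields the continuous representative.\<close>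

definition hardy_cesaro_V :: "(real \<Rightarrow> real) \<Rightarrow> (real \<Rightarrow> complex) \<Rightarrow> real \<Rightarrow> complex"
  where "hardy_cesaro_V \<psi> g x =
    (\<integral>t. g (x / t) * complex_of_real (\<psi> t / t) \<partial>lebesgue_on {0..1})"

text \<open>The adjoint of \<open>V\<^sub>\<psi>\<close>, where a functional on \<open>C\<^sub>0(1/\<omega>\<^sub>2)\<close> is identified with the unique
  element of \<open>M(\<omega>\<^sub>2)\<close> representing it.\<close>

definition hardy_cesaro_ext ::
    "(real \<Rightarrow> real) \<Rightarrow> (real \<Rightarrow> real) \<Rightarrow> (real set \<Rightarrow> complex) \<Rightarrow> real set \<Rightarrow> complex"
  where "hardy_cesaro_ext \<psi> \<omega>2 \<mu> =
    (THE \<nu>. \<nu> \<in> weighted_measures \<omega>2 \<and>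
       (\<forall>g \<in> weighted_C0 \<omega>2.
          complex_measure_integral g \<nu> = complex_measure_integral (hardy_cesaro_V \<psi> g) \<mu>))"

end

theory Submission
  imports Defs
begin

text \<open>
  The reason for the result is a smoothing effect. Write \<open>\<mu> = P\<^sub>0 + \<i> P\<^sub>1 - P\<^sub>2 - \<i> P\<^sub>3\<close> with positive
  measures, each of which integrates \<open>\<omega>1\<close>. For a positive measure \<open>P\<close> let \<open>Q\<close> be the image of the
  product of \<open>P\<close> with \<open>\<psi>(t)/t dt\<close> on \<open>(0,1]\<close> under the map \<open>(s, t) \<mapsto> s/t\<close>. Fubini's theorem
  turns \<open>\<integral> g dQ\<close> into the integral against \<open>P\<close> of \<open>s \<mapsto> \<integral> g(s/t) \<psi>(t)/t dt\<close>. With \<open>g = \<omega>2\<close> the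
  hypothesis gives \<open>\<integral> \<omega>2 dQ \<le> C \<integral> \<omega>1 dP\<close>; with \<open>g\<close> in \<open>C\<^sub>0(1/\<omega>2)\<close> it shows that
  \<open>Q\<^sub>0 + \<i> Q\<^sub>1 - Q\<^sub>2 - \<i> Q\<^sub>3\<close> represents the functional that defines the extended operator at \<open>\<mu>\<close>.

  If \<open>A\<close> is a Lebesgue null subset of the open half-line, then \<open>{t. s/t \<in> A}\<close> is null for every
  \<open>s\<close>, because \<open>y \<mapsto> s/y\<close> is differentiable there. So \<open>Q(A) = 0\<close> (lemma
  \<open>null_set_cesaro_image\<close>), and by the Radon-Nikodym theorem \<open>Q\<close> has a density on the open half-line;
  only an atom at \<open>0\<close> is left (lemma \<open>density_plus_atom_decomposition\<close>). The density inherits the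
  integrability of \<open>\<omega>2\<close>.

  Three facts about complex measures connect this with the definition of the operator. The
  variations are measures and yield the decomposition of \<open>\<mu>\<close> (lemma
  \<open>weighted_measures_eq_complex_combination\<close>). The integral against a complex measure does not depend
  on the decomposition from which it is computed (lemma
  \<open>complex_measure_integral_complex_combination\<close>); this matters because the \<open>Q\<^sub>k\<close> need not be
  mutually singular. A measure in \<open>M(\<omega>)\<close> is determined by its integrals of functions in
  \<open>C\<^sub>0(1/\<omega>)\<close> (lemma \<open>complex_measure_integral_determines\<close>), so that the measure found above is the
  value of the operator.
\<close>

section \<open>Bounded Borel sets of the half-line\<close>

abbreviation half_line :: "real measure"
  where "half_line \<equiv> restrict_space borel {0..}"

lemma sets_half_line: "A \<in> sets half_line \<longleftrightarrow> A \<in> sets borel \<and> A \<subseteq> {0..}"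
  by (auto simp: sets_restrict_space_iff)

lemma bounded_borel_half_line: "A \<in> bounded_borel \<Longrightarrow> A \<in> sets half_line"
  by (simp add: bounded_borel_def sets_half_line)

lemma bounded_borel_subset:
  "A \<in> bounded_borel \<Longrightarrow> B \<in> sets borel \<Longrightarrow> B \<subseteq> A \<Longrightarrow> B \<in> bounded_borel"
  by (auto simp: bounded_borel_def intro: bounded_subset)

lemma bounded_borel_Int:
  "A \<in> bounded_borel \<Longrightarrow> B \<in> sets half_line \<Longrightarrow> A \<inter> B \<in> bounded_borel"
  by (rule bounded_borel_subset[of A]) (auto simp: bounded_borel_def sets_half_line)

lemma bounded_borel_Diff:
  "A \<in> bounded_borel \<Longrightarrow> B \<in> bounded_borel \<Longrightarrow> A - B \<in> bounded_borel"
  by (rule bounded_borel_subset[of A]) (auto simp: bounded_borel_def)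

lemma bounded_borel_atLeastAtMost: "0 \<le> a \<Longrightarrow> {a..b} \<in> bounded_borel"
  by (auto simp: bounded_borel_def)

lemma bounded_borel_empty [simp]: "{} \<in> bounded_borel"
  by (simp add: bounded_borel_def)

lemma bounded_borel_UN_lessThan:
  "(\<And>i. i < n \<Longrightarrow> A i \<in> bounded_borel) \<Longrightarrow> (\<Union>i<(n::nat). A i) \<in> bounded_borel"
  by (force simp: bounded_borel_def)

lemma bounded_borel_subset_interval:
  assumes "A \<in> bounded_borel"
  obtains b where "0 \<le> b" "A \<subseteq> {0..b}"
proof -
  from assms obtain b where "\<And>x. x \<in> A \<Longrightarrow> norm x \<le> b" "A \<subseteq> {0..}"
    by (auto simp: bounded_borel_def bounded_iff)
  then have "A \<subseteq> {0..max b 0}" by fastforce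
  then show ?thesis using that[of "max b 0"] by auto
qed

section \<open>Additivity on bounded Borel sets\<close>

text \<open>Countable additivity on the bounded Borel sets. It is stated for any normed codomain so that it
  passes from a complex measure to its real and imaginary part and to their negatives.\<close>

definition bounded_additive :: "(real set \<Rightarrow> 'a::real_normed_vector) \<Rightarrow> bool"
  where "bounded_additive \<nu> \<longleftrightarrow>
    (\<forall>A :: nat \<Rightarrow> real set. range A \<subseteq> bounded_borel \<and> disjoint_family A \<and> (\<Union>n. A n) \<in> bounded_borel
       \<longrightarrow> (\<lambda>n. \<nu> (A n)) sums \<nu> (\<Union>n. A n))"

lemma bounded_additiveD:
  assumes "bounded_additive \<nu>" "\<And>n::nat. A n \<in> bounded_borel" "disjoint_family A"
    "(\<Union>n. A n) \<in> bounded_borel"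
  shows "(\<lambda>n. \<nu> (A n)) sums \<nu> (\<Union>n. A n)"
  using assms unfolding bounded_additive_def by blast

lemma loc_finite_complex_measure_iff:
  "loc_finite_complex_measure \<mu> \<longleftrightarrow>
     bounded_additive \<mu> \<and> (\<forall>A. A \<notin> bounded_borel \<longrightarrow> \<mu> A = 0)"
proof (intro iffI conjI)
  assume L: "loc_finite_complex_measure \<mu>"
  show "bounded_additive \<mu>"
    unfolding bounded_additive_def
  proof (intro allI impI, elim conjE)
    fix A :: "nat \<Rightarrow> real set"
    assume A: "range A \<subseteq> bounded_borel" "disjoint_family A" "(\<Union>n. A n) \<in> bounded_borel"
    obtain b where b: "(\<Union>n. A n) \<subseteq> {0..b}"
      using bounded_borel_subset_interval[OF A(3)] by blast
    have "compact {0..b}" "{0..b} \<subseteq> {0..}" by auto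
    moreover have "range A \<subseteq> {B \<in> sets borel. B \<subseteq> {0..b}}"
      using A(1) b by (auto simp: bounded_borel_def)
    ultimately show "(\<lambda>n. \<mu> (A n)) sums \<mu> (\<Union>n. A n)"
      using L A(2) unfolding loc_finite_complex_measure_def by blast
  qed
next
  assume "loc_finite_complex_measure \<mu>"
  then show "\<forall>A. A \<notin> bounded_borel \<longrightarrow> \<mu> A = 0"
    unfolding loc_finite_complex_measure_def by blast
next
  assume L: "bounded_additive \<mu> \<and> (\<forall>A. A \<notin> bounded_borel \<longrightarrow> \<mu> A = 0)"
  show "loc_finite_complex_measure \<mu>"
    unfolding loc_finite_complex_measure_def
  proof (intro conjI allI impI; (elim conjE)?)
    fix K :: "real set" and A :: "nat \<Rightarrow> real set"
    assume K: "compact K" "K \<subseteq> {0..}"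
      and A: "range A \<subseteq> {B \<in> sets borel. B \<subseteq> K}" "disjoint_family A"
    have "K \<in> bounded_borel"
      using K by (auto simp: bounded_borel_def compact_imp_bounded compact_imp_closed borel_closed)
    then have "A n \<in> bounded_borel" "(\<Union>n. A n) \<in> bounded_borel" for n
      by (rule bounded_borel_subset; use A in blast)+
    then show "(\<lambda>n. \<mu> (A n)) sums \<mu> (\<Union>n. A n)"
      using L A(2) by (blast intro: bounded_additiveD)
  qed (use L in blast)
qed

lemma bounded_additive_linear:
  assumes "bounded_additive \<nu>" "bounded_linear h"
  shows "bounded_additive (\<lambda>A. h (\<nu> A))"
  unfolding bounded_additive_def
proof (intro allI impI, elim conjE)
  fix A :: "nat \<Rightarrow> real set"
  assume "range A \<subseteq> bounded_borel" "disjoint_family A" "(\<Union>n. A n) \<in> bounded_borel"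
  then have "(\<lambda>n. \<nu> (A n)) sums \<nu> (\<Union>n. A n)"
    by (intro bounded_additiveD[OF assms(1)]) auto
  then show "(\<lambda>n. h (\<nu> (A n))) sums h (\<nu> (\<Union>n. A n))"
    by (rule bounded_linear.sums[OF assms(2)])
qed

lemma bounded_additive_empty:
  assumes "bounded_additive \<nu>"
  shows "\<nu> {} = 0"
proof -
  have "(\<lambda>n::nat. \<nu> {}) sums \<nu> (\<Union>n::nat. {})"
    by (rule bounded_additiveD[OF assms]) (auto simp: disjoint_family_on_def)
  then show ?thesis
    using sums_summable summable_const_iff by blast
qed

lemma bounded_additive_UN_lessThan:
  assumes "bounded_additive \<nu>" "\<And>i. i < n \<Longrightarrow> A i \<in> bounded_borel" "disjoint_family_on A {..<n::nat}"
  shows "\<nu> (\<Union>i<n. A i) = (\<Sum>i<n. \<nu> (A i))"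
proof -
  let ?A = "\<lambda>i. if i < n then A i else {}"
  have U: "(\<Union>i. ?A i) = (\<Union>i<n. A i)" by (auto split: if_splits)
  have "(\<lambda>i. \<nu> (?A i)) sums \<nu> (\<Union>i. ?A i)"
  proof (rule bounded_additiveD[OF assms(1)])
    show "(\<Union>i. ?A i) \<in> bounded_borel"
      unfolding U using assms(2) by (rule bounded_borel_UN_lessThan)
  qed (use assms(2,3) in \<open>auto simp: disjoint_family_on_def\<close>)
  moreover have "(\<lambda>i. \<nu> (?A i)) sums (\<Sum>i<n. \<nu> (?A i))"
    by (rule sums_finite) (auto simp: bounded_additive_empty[OF assms(1)])
  ultimately have "\<nu> (\<Union>i. ?A i) = (\<Sum>i<n. \<nu> (?A i))"
    by (rule sums_unique2)
  then show ?thesis unfolding U by simp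
qed

lemma bounded_additive_Diff:
  assumes "bounded_additive \<nu>" "A \<in> bounded_borel" "B \<in> bounded_borel" "B \<subseteq> A"
  shows "\<nu> (A - B) = \<nu> A - \<nu> B"
proof -
  let ?A = "\<lambda>i::nat. if i = 0 then B else A - B"
  have "\<nu> (\<Union>i<2. ?A i) = (\<Sum>i<2. \<nu> (?A i))"
    using assms bounded_borel_Diff
    by (intro bounded_additive_UN_lessThan) (auto simp: disjoint_family_on_def)
  moreover have "(\<Union>i<2. ?A i) = A" using assms(4) by (auto simp: numeral_2_eq_2 lessThan_Suc)
  ultimately show ?thesis by (simp add: numeral_2_eq_2)
qed

section \<open>The variation measures\<close>

text \<open>A supremum may be taken in each summand separately. A partial sum involves only finitely many
  choices, and \<open>T\<close> below collects the summands whose supremum has already been taken, so that no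
  \<open>\<epsilon>\<close> has to be distributed over the summands. This is the superadditive half of the
  countable additivity of both variations.\<close>

lemma suminf_SUP_le:
  fixes a :: "nat \<Rightarrow> 'a \<Rightarrow> ennreal"
  assumes ne: "\<And>i. X i \<noteq> {}"
    and le: "\<And>e n. (\<And>i. e i \<in> X i) \<Longrightarrow> (\<Sum>i<n. a i (e i)) \<le> S"
  shows "(\<Sum>i. SUP x\<in>X i. a i x) \<le> S"
proof (rule suminf_le_const)
  fix n
  have "(\<Sum>i<n. SUP x\<in>X i. a i x) + T \<le> S"
    if "\<And>e. (\<And>i. e i \<in> X i) \<Longrightarrow> (\<Sum>i<n. a i (e i)) + T \<le> S" for T
    using that
  proof (induction n arbitrary: T)
    case 0
    have "(SOME x. x \<in> X i) \<in> X i" for i using ne by (simp add: some_in_eq)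
    from 0[OF this] show ?case by simp
  next
    case (Suc n)
    have *: "(\<Sum>i<n. SUP x\<in>X i. a i x) + (a n x + T) \<le> S" if x: "x \<in> X n" for x
    proof (rule Suc.IH)
      fix e assume e: "\<And>i. e i \<in> X i"
      have "(\<Sum>i<Suc n. a i ((e(n := x)) i)) + T \<le> S"
        using e x by (intro Suc.prems) auto
      then show "(\<Sum>i<n. a i (e i)) + (a n x + T) \<le> S" by (simp add: add.assoc)
    qed
    have "(\<Sum>i<Suc n. SUP x\<in>X i. a i x) + T
        = (SUP x\<in>X n. a n x) + ((\<Sum>i<n. SUP x\<in>X i. a i x) + T)"
      by (simp add: ac_simps)
    also have "\<dots> = (SUP x\<in>X n. a n x + ((\<Sum>i<n. SUP x\<in>X i. a i x) + T))"
      using ne by (simp add: ennreal_SUP_add_left)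
    also have "\<dots> \<le> S"
      using * by (intro SUP_least) (simp add: ac_simps)
    finally show ?case .
  qed
  from this[of 0] show "(\<Sum>i<n. SUP x\<in>X i. a i x) \<le> S"
    using le by simp
qed simp

lemma emeasure_measure_of_half_line:
  assumes "F {} = 0"
    and "\<And>A :: nat \<Rightarrow> real set. range A \<subseteq> sets half_line \<Longrightarrow> disjoint_family A \<Longrightarrow>
      (\<Union>i. A i) \<in> sets half_line \<Longrightarrow> (\<Sum>i. F (A i)) = F (\<Union>i. A i)"
    and "A \<in> sets half_line"
  shows "emeasure (measure_of {0..} (sets half_line) F) A = F A"
proof (rule emeasure_measure_of_sigma)
  have "space half_line = {0..}" by simp
  then show "sigma_algebra {0..} (sets half_line)"
    by (metis sets.sigma_algebra_axioms)
  show "positive (sets half_line) F" using assms(1) by (simp add: positive_def)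
  show "countably_additive (sets half_line) F" using assms(2) by (simp add: countably_additive_def)
qed (use assms in auto)

lemma sets_measure_of_half_line [simp]: "sets (measure_of {0..} (sets half_line) F) = sets half_line"
  using sets.sets_measure_of_eq[of half_line F] by (simp add: space_restrict_space)

lemma sets_upper_variation [simp, measurable_cong]: "sets (upper_variation \<nu>) = sets half_line"
  by (simp add: upper_variation_def)

lemma sets_total_variation [simp, measurable_cong]: "sets (total_variation \<nu>) = sets half_line"
  by (simp add: total_variation_def)

text \<open>Here and for the total variation, subadditivity cuts a competitor for the union along the sets
  of the family, and superadditivity glues competitors for the single sets.\<close>

lemma emeasure_upper_variation:
  assumes \<nu>: "bounded_additive \<nu>" and A: "A \<in> sets half_line"
  shows "emeasure (upper_variation \<nu>) A = (SUP B \<in> {B \<in> bounded_borel. B \<subseteq> A}. ennreal (\<nu> B))"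
  unfolding upper_variation_def
proof (rule emeasure_measure_of_half_line)
  let ?F = "\<lambda>A. SUP B \<in> {B \<in> bounded_borel. B \<subseteq> A}. ennreal (\<nu> B)"
  show "?F {} = 0"
    by (intro antisym SUP_least) (auto simp: bounded_additive_empty[OF \<nu>])
  fix A :: "nat \<Rightarrow> real set"
  assume A: "range A \<subseteq> sets half_line" "disjoint_family A"
  show "(\<Sum>i. ?F (A i)) = ?F (\<Union>i. A i)"
  proof (rule antisym)
    show "(\<Sum>i. ?F (A i)) \<le> ?F (\<Union>i. A i)"
    proof (rule suminf_SUP_le)
      have "{} \<in> {B \<in> bounded_borel. B \<subseteq> A i}" for i by simp
      then show "{B \<in> bounded_borel. B \<subseteq> A i} \<noteq> {}" for i by (metis empty_iff)
      fix e :: "nat \<Rightarrow> real set" and n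
      assume "\<And>i. e i \<in> {B \<in> bounded_borel. B \<subseteq> A i}"
      then have e: "e i \<in> bounded_borel" "e i \<subseteq> A i" for i by auto
      \<comment> \<open>Pieces of negative value are traded for the empty set, whose value is the truncated one.\<close>
      define B where "B i = (if \<nu> (e i) \<ge> 0 then e i else {})" for i
      have B: "B i \<in> bounded_borel" "B i \<subseteq> A i" for i
        using e[of i] by (auto simp: B_def)
      have dB: "disjoint_family B"
        using A(2) B(2) unfolding disjoint_family_on_def by blast
      have \<nu>B: "ennreal (\<nu> (e i)) = ennreal (\<nu> (B i))" "0 \<le> \<nu> (B i)" for i
        by (auto simp: B_def bounded_additive_empty[OF \<nu>] ennreal_neg)
      have "(\<Sum>i<n. ennreal (\<nu> (e i))) = ennreal (\<Sum>i<n. \<nu> (B i))"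
        using \<nu>B by (simp add: sum_ennreal)
      also have "(\<Sum>i<n. \<nu> (B i)) = \<nu> (\<Union>i<n. B i)"
        using B dB by (intro bounded_additive_UN_lessThan[OF \<nu>, symmetric])
          (auto simp: disjoint_family_on_def)
      also have "ennreal \<dots> \<le> ?F (\<Union>i. A i)"
        using B by (intro SUP_upper) (auto intro!: bounded_borel_UN_lessThan)
      finally show "(\<Sum>i<n. ennreal (\<nu> (e i))) \<le> ?F (\<Union>i. A i)" .
    qed
    show "?F (\<Union>i. A i) \<le> (\<Sum>i. ?F (A i))"
    proof (rule SUP_least)
      fix B assume "B \<in> {B \<in> bounded_borel. B \<subseteq> (\<Union>i. A i)}"
      then have B: "B \<in> bounded_borel" "B \<subseteq> (\<Union>i. A i)" by auto
      have BA: "B \<inter> A i \<in> bounded_borel" for i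
        using A(1) B(1) by (intro bounded_borel_Int) auto
      have U: "(\<Union>i. B \<inter> A i) = B" using B by auto
      have "(\<lambda>i. \<nu> (B \<inter> A i)) sums \<nu> (\<Union>i. B \<inter> A i)"
        using A(2) BA B(1) unfolding disjoint_family_on_def
        by (intro bounded_additiveD[OF \<nu>]) (auto simp: U disjoint_family_on_def simp del: UN_simps)
      then have sm: "(\<lambda>i. \<nu> (B \<inter> A i)) sums \<nu> B" unfolding U .
      have "ennreal (\<nu> B) \<le> (\<Sum>i. ennreal (\<nu> (B \<inter> A i)))"
      proof (rule LIMSEQ_le_const2)
        show "(\<lambda>n. ennreal (\<Sum>i<n. \<nu> (B \<inter> A i))) \<longlonglongrightarrow> ennreal (\<nu> B)"
          using sm by (intro tendsto_ennrealI) (simp add: sums_def)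
        have "ennreal (\<Sum>i<n. \<nu> (B \<inter> A i)) \<le> (\<Sum>i. ennreal (\<nu> (B \<inter> A i)))" for n
        proof -
          have "ennreal (\<Sum>i<n. \<nu> (B \<inter> A i)) \<le> ennreal (\<Sum>i<n. max 0 (\<nu> (B \<inter> A i)))"
            by (intro ennreal_leI sum_mono) auto
          also have "\<dots> = (\<Sum>i<n. ennreal (\<nu> (B \<inter> A i)))"
            by (subst sum_ennreal[symmetric]) (auto simp: max_def ennreal_neg simp del: sum_ennreal intro!: sum.cong)
          also have "\<dots> \<le> (\<Sum>i. ennreal (\<nu> (B \<inter> A i)))" by (rule sum_le_suminf) auto
          finally show ?thesis .
        qed
        then show "\<exists>N. \<forall>n\<ge>N. ennreal (\<Sum>i<n. \<nu> (B \<inter> A i)) \<le> (\<Sum>i. ennreal (\<nu> (B \<inter> A i)))" by blast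
      qed
      also have "\<dots> \<le> (\<Sum>i. ?F (A i))"
        using BA by (intro suminf_le) (auto intro!: SUP_upper)
      finally show "ennreal (\<nu> B) \<le> (\<Sum>i. ?F (A i))" .
    qed
  qed
qed (rule A)

lemma suminf_ennreal_commute: "(\<Sum>n. \<Sum>i. f n i) = (\<Sum>i::nat. \<Sum>n::nat. (f n i :: ennreal))"
proof -
  have "(\<integral>\<^sup>+ n. (\<Sum>i. f n i) \<partial>count_space UNIV) = (\<Sum>i. \<integral>\<^sup>+ n. f n i \<partial>count_space UNIV)"
    by (rule nn_integral_suminf) simp
  then show ?thesis unfolding nn_integral_count_space_nat .
qed

abbreviation bounded_partitions :: "real set \<Rightarrow> (nat \<Rightarrow> real set) set"
  where "bounded_partitions A \<equiv>
    {E. range E \<subseteq> bounded_borel \<and> disjoint_family E \<and> (\<Union>n. E n) = A}"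

lemma bounded_partitions_nonempty:
  assumes "A \<in> sets half_line"
  shows "bounded_partitions A \<noteq> {}"
proof -
  let ?E = "\<lambda>n::nat. {real n..real n + 1} \<inter> A \<inter> {x. x < real n + 1}"
  have "\<exists>n. x \<in> ?E n" if "x \<in> A" for x
  proof -
    have "0 \<le> x" using that assms by (auto simp: sets_half_line)
    then have "x \<in> ?E (nat \<lfloor>x\<rfloor>)" using that by (auto; linarith)
    then show ?thesis ..
  qed
  moreover have "?E n \<in> bounded_borel" for n
    by (rule bounded_borel_subset[of "{real n..real n + 1}"])
       (use assms bounded_borel_atLeastAtMost in \<open>auto simp: sets_half_line\<close>)
  moreover have "disjoint_family ?E"
    unfolding disjoint_family_on_def by auto
  ultimately have "?E \<in> bounded_partitions A" by blast
  then show ?thesis by blast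
qed

lemma emeasure_total_variation:
  assumes \<mu>: "bounded_additive \<mu>" and A: "A \<in> sets half_line"
  shows "emeasure (total_variation \<mu>) A = (SUP E \<in> bounded_partitions A. \<Sum>n. ennreal (cmod (\<mu> (E n))))"
  unfolding total_variation_def
proof (rule emeasure_measure_of_half_line)
  let ?F = "\<lambda>A. SUP E \<in> bounded_partitions A. \<Sum>n. ennreal (cmod (\<mu> (E n)))"
  show "?F {} = 0"
    by (auto simp: bounded_additive_empty[OF \<mu>] intro!: antisym SUP_least)
  fix A :: "nat \<Rightarrow> real set"
  assume A: "range A \<subseteq> sets half_line" "disjoint_family A"
  show "(\<Sum>i. ?F (A i)) = ?F (\<Union>i. A i)"
  proof (rule antisym)
    show "(\<Sum>i. ?F (A i)) \<le> ?F (\<Union>i. A i)"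
    proof (rule suminf_SUP_le)
      show "bounded_partitions (A i) \<noteq> {}" for i
        using A(1) by (intro bounded_partitions_nonempty) auto
      fix E :: "nat \<Rightarrow> nat \<Rightarrow> real set" and n
      assume "\<And>i. E i \<in> bounded_partitions (A i)"
      then have E: "E i k \<in> bounded_borel" "disjoint_family (E i)" "(\<Union>k. E i k) = A i" for i k
        by blast+
      \<comment> \<open>A doubly indexed family of pieces is a sequence of pieces by way of the pairing function.\<close>
      let ?G = "\<lambda>m. E (fst (prod_decode m)) (snd (prod_decode m))"
      have sub: "E i k \<subseteq> A i" for i k using E(3)[of i] by blast
      have "?G k \<inter> ?G l = {}" if "k \<noteq> l" for k l
      proof (cases "fst (prod_decode k) = fst (prod_decode l)")
        case True
        then have "snd (prod_decode k) \<noteq> snd (prod_decode l)"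
          using that by (metis prod_decode_eq prod_eqI)
        then show ?thesis
          using E(2)[of "fst (prod_decode l)"] True by (auto simp: disjoint_family_on_def)
      next
        case False
        then show ?thesis
          using A(2) sub unfolding disjoint_family_on_def by (metis Int_mono UNIV_I subset_empty)
      qed
      then have dG: "disjoint_family ?G" by (simp add: disjoint_family_on_def)
      have "(\<Union>m. ?G m) = (\<Union>i. A i)"
      proof (intro equalityI subsetI)
        fix x assume "x \<in> (\<Union>i. A i)"
        then obtain i k where "x \<in> E i k" using E(3) by blast
        then have "x \<in> ?G (prod_encode (i, k))" by simp
        then show "x \<in> (\<Union>m. ?G m)" by blast
      qed (use sub in blast)
      with dG E(1) have G: "?G \<in> bounded_partitions (\<Union>i. A i)" by auto
      have "(\<Sum>i<n. \<Sum>k. ennreal (cmod (\<mu> (E i k)))) \<le> (\<Sum>i. \<Sum>k. ennreal (cmod (\<mu> (E i k))))"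
        by (rule sum_le_suminf) auto
      also have "\<dots> = (\<Sum>m. ennreal (cmod (\<mu> (?G m))))"
        by (subst suminf_ennreal_2dimen[symmetric, where f = "\<lambda>(i, k). ennreal (cmod (\<mu> (E i k)))"])
          (simp_all add: case_prod_beta)
      also have "\<dots> \<le> ?F (\<Union>i. A i)"
        by (rule SUP_upper[OF G])
      finally show "(\<Sum>i<n. \<Sum>k. ennreal (cmod (\<mu> (E i k)))) \<le> ?F (\<Union>i. A i)" .
    qed
    show "?F (\<Union>i. A i) \<le> (\<Sum>i. ?F (A i))"
    proof (rule SUP_least)
      fix E assume "E \<in> bounded_partitions (\<Union>i. A i)"
      then have E: "E n \<in> bounded_borel" "disjoint_family E" "(\<Union>n. E n) = (\<Union>i. A i)" for n by auto
      have EA: "E n \<inter> A i \<in> bounded_borel" for n i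
        using A(1) E(1) by (intro bounded_borel_Int) auto
      have "ennreal (cmod (\<mu> (E n))) \<le> (\<Sum>i. ennreal (cmod (\<mu> (E n \<inter> A i))))" for n
      proof -
        have U: "(\<Union>i. E n \<inter> A i) = E n" using E(3) by blast
        have "(\<lambda>i. \<mu> (E n \<inter> A i)) sums \<mu> (\<Union>i. E n \<inter> A i)"
          using A(2) EA E(1) by (intro bounded_additiveD[OF \<mu>])
            (auto simp: U disjoint_family_on_def simp del: UN_simps)
        then have sm: "(\<lambda>i. \<mu> (E n \<inter> A i)) sums \<mu> (E n)" unfolding U .
        show ?thesis
        proof (rule LIMSEQ_le_const2)
          show "(\<lambda>k. ennreal (cmod (\<Sum>i<k. \<mu> (E n \<inter> A i)))) \<longlonglongrightarrow> ennreal (cmod (\<mu> (E n)))"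
            using sm by (intro tendsto_ennrealI tendsto_norm) (simp add: sums_def)
          have "ennreal (cmod (\<Sum>i<k. \<mu> (E n \<inter> A i))) \<le> (\<Sum>i. ennreal (cmod (\<mu> (E n \<inter> A i))))" for k
          proof -
            have "ennreal (cmod (\<Sum>i<k. \<mu> (E n \<inter> A i))) \<le> ennreal (\<Sum>i<k. cmod (\<mu> (E n \<inter> A i)))"
              by (intro ennreal_leI norm_sum)
            also have "\<dots> = (\<Sum>i<k. ennreal (cmod (\<mu> (E n \<inter> A i))))"
              by (subst sum_ennreal[symmetric]) auto
            also have "\<dots> \<le> (\<Sum>i. ennreal (cmod (\<mu> (E n \<inter> A i))))" by (rule sum_le_suminf) auto
            finally show ?thesis .
          qed
          then show "\<exists>N. \<forall>k\<ge>N. ennreal (cmod (\<Sum>i<k. \<mu> (E n \<inter> A i)))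
              \<le> (\<Sum>i. ennreal (cmod (\<mu> (E n \<inter> A i))))" by blast
        qed
      qed
      then have "(\<Sum>n. ennreal (cmod (\<mu> (E n)))) \<le> (\<Sum>n. \<Sum>i. ennreal (cmod (\<mu> (E n \<inter> A i))))"
        by (intro suminf_le) auto
      also have "\<dots> = (\<Sum>i. \<Sum>n. ennreal (cmod (\<mu> (E n \<inter> A i))))"
        by (rule suminf_ennreal_commute)
      also have "\<dots> \<le> (\<Sum>i. ?F (A i))"
      proof (intro suminf_le SUP_upper)
        show "(\<lambda>n. E n \<inter> A i) \<in> bounded_partitions (A i)" for i
          using E EA by (auto simp: disjoint_family_on_def)
      qed auto
      finally show "(\<Sum>n. ennreal (cmod (\<mu> (E n)))) \<le> (\<Sum>i. ?F (A i))" .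
    qed
  qed
qed (rule A)

text \<open>With \<open>z\<close> a power of \<open>\<i>\<close> this bounds the positive and negative parts of the real and the
  imaginary part of \<open>\<mu>\<close> by \<open>|\<mu>|\<close>. The one-piece partition of a subset \<open>B\<close> of \<open>A\<close> suffices.\<close>

lemma emeasure_upper_variation_Re_le_total_variation:
  assumes \<mu>: "bounded_additive \<mu>" and z: "cmod z = 1" and A: "A \<in> sets half_line"
  shows "emeasure (upper_variation (\<lambda>A. Re (z * \<mu> A))) A \<le> emeasure (total_variation \<mu>) A"
proof -
  have ba: "bounded_additive (\<lambda>A. Re (z * \<mu> A))"
    using \<mu> by (rule bounded_additive_linear)
      (intro bounded_linear_compose[OF bounded_linear_Re] bounded_linear_mult_right)
  show ?thesis
    unfolding emeasure_upper_variation[OF ba A]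
  proof (rule SUP_least)
    fix B assume "B \<in> {B \<in> bounded_borel. B \<subseteq> A}"
    then have B: "B \<in> bounded_borel" "B \<subseteq> A" by auto
    let ?E = "\<lambda>n::nat. if n = 0 then B else {}"
    have "ennreal (Re (z * \<mu> B)) \<le> ennreal (cmod (\<mu> B))"
      using complex_Re_le_cmod[of "z * \<mu> B"] z by (intro ennreal_leI) (simp add: norm_mult)
    also have "\<dots> = (\<Sum>n<1. ennreal (cmod (\<mu> (?E n))))" by simp
    also have "\<dots> \<le> (\<Sum>n. ennreal (cmod (\<mu> (?E n))))" by (rule sum_le_suminf) auto
    also have "\<dots> \<le> emeasure (total_variation \<mu>) B"
      unfolding emeasure_total_variation[OF \<mu> bounded_borel_half_line[OF B(1)]]
      using B by (intro SUP_upper) (auto simp: disjoint_family_on_def split: if_splits)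
    also have "\<dots> \<le> emeasure (total_variation \<mu>) A"
      using A B by (intro emeasure_mono) auto
    finally show "ennreal (Re (z * \<mu> B)) \<le> emeasure (total_variation \<mu>) A" .
  qed
qed

text \<open>The reason is the identity \<open>\<nu>(B) = \<nu>(A) - \<nu>(A - B)\<close> for \<open>B \<subseteq> A\<close>: the supremum of
  \<open>\<nu>(B)\<close> is \<open>\<nu>(A)\<close> plus the supremum of \<open>-\<nu>(A - B)\<close>. Finiteness is what allows the
  subtraction.\<close>

lemma jordan_decomposition:
  assumes \<nu>: "bounded_additive \<nu>" and A: "A \<in> bounded_borel"
    and fin: "emeasure (upper_variation \<nu>) A < \<infinity>"
      "emeasure (upper_variation (\<lambda>A. - \<nu> A)) A < \<infinity>"
  shows "\<nu> A = measure (upper_variation \<nu>) A - measure (upper_variation (\<lambda>A. - \<nu> A)) A"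
proof -
  have \<nu>': "bounded_additive (\<lambda>A. - \<nu> A)"
    by (rule bounded_additive_linear[OF \<nu> bounded_linear_minus[OF bounded_linear_ident]])
  have key: "measure (upper_variation \<nu>) A \<le> \<nu> A + measure (upper_variation (\<lambda>A. - \<nu> A)) A"
    if "bounded_additive \<nu>" "bounded_additive (\<lambda>A. - \<nu> A)"
      "emeasure (upper_variation (\<lambda>A. - \<nu> A)) A < \<infinity>" for \<nu>
  proof -
    have le: "- \<nu> B \<le> measure (upper_variation (\<lambda>A. - \<nu> A)) A" if "B \<in> bounded_borel" "B \<subseteq> A" for B
    proof -
      have "ennreal (- \<nu> B) \<le> emeasure (upper_variation (\<lambda>A. - \<nu> A)) A"
        unfolding emeasure_upper_variation[OF \<open>bounded_additive (\<lambda>A. - \<nu> A)\<close> bounded_borel_half_line[OF A]]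
        using that by (intro SUP_upper) auto
      also have "\<dots> = ennreal (measure (upper_variation (\<lambda>A. - \<nu> A)) A)"
        using \<open>emeasure (upper_variation (\<lambda>A. - \<nu> A)) A < \<infinity>\<close>
        by (intro emeasure_eq_ennreal_measure) auto
      finally show ?thesis by (simp add: ennreal_le_iff)
    qed
    have "emeasure (upper_variation \<nu>) A \<le> ennreal (\<nu> A + measure (upper_variation (\<lambda>A. - \<nu> A)) A)"
      unfolding emeasure_upper_variation[OF \<open>bounded_additive \<nu>\<close> bounded_borel_half_line[OF A]]
    proof (intro SUP_least ennreal_leI)
      fix B assume "B \<in> {B \<in> bounded_borel. B \<subseteq> A}"
      then have B: "B \<in> bounded_borel" "B \<subseteq> A" by auto
      show "\<nu> B \<le> \<nu> A + measure (upper_variation (\<lambda>A. - \<nu> A)) A"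
        using le[of "A - B"] bounded_additive_Diff[OF \<open>bounded_additive \<nu>\<close> A B]
          bounded_borel_Diff[OF A B(1)] by auto
    qed
    then show ?thesis
      using le[OF A] by (simp add: measure_def enn2real_leI)
  qed
  show ?thesis
    using key[of \<nu>, OF \<nu> \<nu>' fin(2)] key[of "\<lambda>A. - \<nu> A", OF \<nu>'] \<nu> fin(1) by simp
qed

section \<open>Integrals against sums of measures\<close>

lemma sum_list_SUP_ennreal:
  fixes f :: "'a \<Rightarrow> nat \<Rightarrow> ennreal"
  assumes "\<And>x. x \<in> set xs \<Longrightarrow> incseq (f x)"
  shows "(\<Sum>x\<leftarrow>xs. SUP i. f x i) = (SUP i. \<Sum>x\<leftarrow>xs. f x i)"
  using assms
proof (induction xs)
  case (Cons x xs)
  have "incseq (\<lambda>i. \<Sum>x\<leftarrow>xs. f x i)"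
    using Cons.prems by (auto simp: incseq_def intro!: sum_list_mono)
  then have "(SUP i. f x i + (\<Sum>x\<leftarrow>xs. f x i)) = (SUP i. f x i) + (SUP i. \<Sum>x\<leftarrow>xs. f x i)"
    using Cons.prems by (intro ennreal_SUP_add) auto
  then show ?case using Cons by simp
qed simp

text \<open>An inequality between sums of measures integrates. Sums of measures are kept as lists of
  summands: identities such as \<open>P - N = P' - N'\<close> between differences of measures are used in the
  form \<open>P + N' = P' + N\<close>, where all terms are positive and infinite values do no harm.\<close>

lemma sum_list_nn_integral_mono_measure:
  assumes sets: "\<And>M. M \<in> set Ms \<union> set Ns \<Longrightarrow> sets M = sets L"
    and le: "\<And>A. A \<in> sets L \<Longrightarrow> (\<Sum>M\<leftarrow>Ms. emeasure M A) \<le> (\<Sum>M\<leftarrow>Ns. emeasure M A)"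
    and h: "h \<in> borel_measurable L"
  shows "(\<Sum>M\<leftarrow>Ms. \<integral>\<^sup>+x. h x \<partial>M) \<le> (\<Sum>M\<leftarrow>Ns. \<integral>\<^sup>+x. h x \<partial>M)"
proof -
  have meas: "u \<in> borel_measurable M"
    if "u \<in> borel_measurable L" "set Ls \<subseteq> set Ms \<union> set Ns" "M \<in> set Ls" for u :: "'a \<Rightarrow> ennreal" and Ls M
  proof -
    have "sets M = sets L" using that(2,3) sets by blast
    from measurable_cong_sets[OF this refl, of "borel :: ennreal measure"] show ?thesis using that(1) by simp
  qed
  show ?thesis
    using h
  proof (induction rule: borel_measurable_induct)
    case (cong f g)
    have "(\<Sum>M\<leftarrow>Ls. \<integral>\<^sup>+x. f x \<partial>M) = (\<Sum>M\<leftarrow>Ls. \<integral>\<^sup>+x. g x \<partial>M)" if "set Ls \<subseteq> set Ms \<union> set Ns" for Ls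
      using that sets cong(3)
      by (intro arg_cong[where f = sum_list] map_cong refl nn_integral_cong)
         (metis sets_eq_imp_space_eq subsetD)
    then show ?case using cong(4) by simp
  next
    case (set A)
    have "(\<Sum>M\<leftarrow>Ls. \<integral>\<^sup>+x. indicator A x \<partial>M) = (\<Sum>M\<leftarrow>Ls. emeasure M A)" if "set Ls \<subseteq> set Ms \<union> set Ns" for Ls
      using that sets set
      by (intro arg_cong[where f = sum_list] map_cong refl nn_integral_indicator) auto
    then show ?case using le set by simp
  next
    case (mult u c)
    have "(\<Sum>M\<leftarrow>Ls. \<integral>\<^sup>+x. c * u x \<partial>M) = c * (\<Sum>M\<leftarrow>Ls. \<integral>\<^sup>+x. u x \<partial>M)" if "set Ls \<subseteq> set Ms \<union> set Ns" for Ls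
      unfolding sum_list_const_mult[symmetric]
      by (intro arg_cong[where f = sum_list] map_cong refl nn_integral_cmult) (rule meas[OF mult(2) that])
    then show ?case using mult by (simp add: mult_left_mono)
  next
    case (add u v)
    have "(\<Sum>M\<leftarrow>Ls. \<integral>\<^sup>+x. v x + u x \<partial>M) = (\<Sum>M\<leftarrow>Ls. \<integral>\<^sup>+x. v x \<partial>M) + (\<Sum>M\<leftarrow>Ls. \<integral>\<^sup>+x. u x \<partial>M)"
      if "set Ls \<subseteq> set Ms \<union> set Ns" for Ls
      unfolding sum_list_addf[symmetric]
      by (intro arg_cong[where f = sum_list] map_cong refl nn_integral_add)
        (rule meas[OF _ that], (rule add | assumption)+)+
    then show ?case using add by (simp add: add_mono)
  next
    case (seq U)
    have "(\<Sum>M\<leftarrow>Ls. \<integral>\<^sup>+x. (SUP i. U i x) \<partial>M) = (SUP i. \<Sum>M\<leftarrow>Ls. \<integral>\<^sup>+x. U i x \<partial>M)"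
      if Ls: "set Ls \<subseteq> set Ms \<union> set Ns" for Ls
    proof -
      have "(\<Sum>M\<leftarrow>Ls. \<integral>\<^sup>+x. (SUP i. U i x) \<partial>M) = (\<Sum>M\<leftarrow>Ls. (SUP i. \<integral>\<^sup>+x. U i x \<partial>M))"
      proof (intro arg_cong[where f = sum_list] map_cong refl nn_integral_monotone_convergence_SUP)
        fix M i assume "M \<in> set Ls"
        then show "U i \<in> borel_measurable M" by (rule meas[OF seq(1) Ls])
      qed (rule seq)
      also have "\<dots> = (SUP i. \<Sum>M\<leftarrow>Ls. \<integral>\<^sup>+x. U i x \<partial>M)"
        using seq(3) by (intro sum_list_SUP_ennreal) (auto simp: incseq_def le_fun_def intro!: nn_integral_mono)
      finally show ?thesis .
    qed
    then show ?case using seq.IH by (auto simp: image_comp intro!: SUP_mono)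
  qed
qed

lemma emeasure_half_line_eq_SUP:
  assumes "sets M = sets half_line" "A \<in> sets half_line"
  shows "emeasure M A = (SUP n. emeasure M (A \<inter> {0..real n}))"
proof -
  have "(\<Union>n. A \<inter> {0..real n}) = A"
  proof (intro equalityI subsetI)
    fix x assume "x \<in> A"
    moreover from this have "0 \<le> x" using assms(2) by (auto simp: sets_half_line)
    moreover have "x \<le> real (nat \<lceil>x\<rceil>)" by linarith
    ultimately show "x \<in> (\<Union>n. A \<inter> {0..real n})" by (auto intro: real_arch_simple)
  qed auto
  moreover have "A \<inter> {0..real n} \<in> sets half_line" for n
    using assms(2) by (auto simp: sets_half_line)
  moreover have "incseq (\<lambda>n. A \<inter> {0..real n})" by (auto simp: incseq_def)
  ultimately show ?thesis
    using SUP_emeasure_incseq[of "\<lambda>n. A \<inter> {0..real n}" M] assms(1)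
    by (simp add: image_subset_iff del: UN_simps)
qed

lemma sum_list_nn_integral_mono_bounded_borel:
  assumes sets: "\<And>M. M \<in> set Ms \<union> set Ns \<Longrightarrow> sets M = sets half_line"
    and le: "\<And>A. A \<in> bounded_borel \<Longrightarrow> (\<Sum>M\<leftarrow>Ms. emeasure M A) \<le> (\<Sum>M\<leftarrow>Ns. emeasure M A)"
    and h: "h \<in> borel_measurable half_line"
  shows "(\<Sum>M\<leftarrow>Ms. \<integral>\<^sup>+x. h x \<partial>M) \<le> (\<Sum>M\<leftarrow>Ns. \<integral>\<^sup>+x. h x \<partial>M)"
  using sets _ h
proof (rule sum_list_nn_integral_mono_measure)
  fix A assume A: "A \<in> sets half_line"
  have "(\<Sum>M\<leftarrow>Ls. emeasure M A) = (SUP n. \<Sum>M\<leftarrow>Ls. emeasure M (A \<inter> {0..real n}))"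
    if Ls: "set Ls \<subseteq> set Ms \<union> set Ns" for Ls
  proof -
    have "(\<Sum>M\<leftarrow>Ls. emeasure M A) = (\<Sum>M\<leftarrow>Ls. SUP n. emeasure M (A \<inter> {0..real n}))"
      using Ls sets A
      by (intro arg_cong[where f = sum_list] map_cong refl emeasure_half_line_eq_SUP) auto
    also have "\<dots> = (SUP n. \<Sum>M\<leftarrow>Ls. emeasure M (A \<inter> {0..real n}))"
    proof (intro sum_list_SUP_ennreal incseq_SucI emeasure_mono)
      fix M n assume "M \<in> set Ls"
      then have "sets M = sets half_line" using Ls sets by blast
      then show "A \<inter> {0..real (Suc n)} \<in> sets M" using A by (simp only: sets_half_line) auto
    qed auto
    finally show ?thesis .
  qed
  moreover have "A \<inter> {0..real n} \<in> bounded_borel" for n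
    using bounded_borel_Int[OF bounded_borel_atLeastAtMost A, of 0 "real n"] by (simp add: Int_commute)
  ultimately show "(\<Sum>M\<leftarrow>Ms. emeasure M A) \<le> (\<Sum>M\<leftarrow>Ns. emeasure M A)"
    using le by (auto intro!: SUP_mono)
qed

section \<open>Locally finite positive measures\<close>

definition locally_finite :: "real measure \<Rightarrow> bool"
  where "locally_finite P \<longleftrightarrow> sets P = sets half_line \<and> (\<forall>A \<in> bounded_borel. emeasure P A < \<infinity>)"

lemma locally_finite_sets: "locally_finite P \<Longrightarrow> sets P = sets half_line"
  by (simp add: locally_finite_def)

lemma locally_finite_emeasure:
  "locally_finite P \<Longrightarrow> A \<in> bounded_borel \<Longrightarrow> emeasure P A = ennreal (measure P A)"
  by (auto simp: locally_finite_def intro!: emeasure_eq_ennreal_measure)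

lemma locally_finite_space: "locally_finite P \<Longrightarrow> space P = {0..}"
  using sets_eq_imp_space_eq[OF locally_finite_sets, of P] by (simp add: space_restrict_space)

lemma sigma_finite_locally_finite:
  assumes "locally_finite P"
  shows "sigma_finite_measure P"
proof
  have "(\<Union>n. {0..real n}) = {0..}"
    using real_arch_simple by auto
  moreover have "emeasure P {0..real n} \<noteq> \<infinity>" "{0..real n} \<in> sets P" for n
    using assms bounded_borel_atLeastAtMost[of 0 "real n"] by (auto simp: locally_finite_def sets_half_line)
  ultimately show "\<exists>A. countable A \<and> A \<subseteq> sets P \<and> \<Union> A = space P \<and> (\<forall>a\<in>A. emeasure P a \<noteq> \<infinity>)"
    using locally_finite_space[OF assms] by (intro exI[of _ "range (\<lambda>n. {0..real n})"]) auto
qed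

text \<open>A positive continuous weight has a positive minimum on each compact interval.\<close>

lemma locally_finite_if_weight_integrable:
  assumes sets: "sets P = sets half_line"
    and \<omega>: "continuous_on {0..} \<omega>" "\<And>t. 0 \<le> t \<Longrightarrow> 0 < \<omega> t"
    and fin: "(\<integral>\<^sup>+ t. ennreal (\<omega> t) \<partial>P) < \<infinity>"
  shows "locally_finite P"
  unfolding locally_finite_def
proof (intro conjI ballI)
  fix A assume A: "A \<in> bounded_borel"
  obtain b where b: "0 \<le> b" "A \<subseteq> {0..b}" using bounded_borel_subset_interval[OF A] by blast
  have "\<exists>x\<in>{0..b}. \<forall>y\<in>{0..b}. \<omega> x \<le> \<omega> y"
    using b by (intro continuous_attains_inf continuous_on_subset[OF \<omega>(1)]) auto
  then obtain m where m: "0 < m" "\<And>y. y \<in> {0..b} \<Longrightarrow> m \<le> \<omega> y" using \<omega>(2) by force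
  have "ennreal m * emeasure P A = (\<integral>\<^sup>+ t. ennreal m * indicator A t \<partial>P)"
    using bounded_borel_half_line[OF A] sets by (simp add: nn_integral_cmult_indicator)
  also have "\<dots> \<le> (\<integral>\<^sup>+ t. ennreal (\<omega> t) \<partial>P)"
    using m b by (intro nn_integral_mono) (auto simp: indicator_def intro!: ennreal_leI)
  finally have "ennreal m * emeasure P A < \<infinity>" using fin by (rule le_less_trans)
  then show "emeasure P A < \<infinity>" using m(1)
    by (auto simp: ennreal_mult_less_top)
qed (rule sets)

lemma integral_add_cong_measure:
  fixes g :: "real \<Rightarrow> complex"
  assumes sets: "sets P = sets half_line" "sets N = sets half_line"
      "sets P' = sets half_line" "sets N' = sets half_line"
    and eq: "\<And>A. A \<in> bounded_borel \<Longrightarrow> emeasure P A + emeasure N A = emeasure P' A + emeasure N' A"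
    and int: "integrable P g" "integrable N g" "integrable P' g" "integrable N' g"
  shows "(\<integral>t. g t \<partial>P) + (\<integral>t. g t \<partial>N) = (\<integral>t. g t \<partial>P') + (\<integral>t. g t \<partial>N')"
proof -
  have nn: "(\<integral>\<^sup>+t. h t \<partial>P) + (\<integral>\<^sup>+t. h t \<partial>N) = (\<integral>\<^sup>+t. h t \<partial>P') + (\<integral>\<^sup>+t. h t \<partial>N')"
    if "h \<in> borel_measurable half_line" for h
  proof (rule antisym)
    show "(\<integral>\<^sup>+t. h t \<partial>P) + (\<integral>\<^sup>+t. h t \<partial>N) \<le> (\<integral>\<^sup>+t. h t \<partial>P') + (\<integral>\<^sup>+t. h t \<partial>N')"
      using sum_list_nn_integral_mono_bounded_borel[of "[P, N]" "[P', N']", OF _ _ that] sets eq by auto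
    show "(\<integral>\<^sup>+t. h t \<partial>P') + (\<integral>\<^sup>+t. h t \<partial>N') \<le> (\<integral>\<^sup>+t. h t \<partial>P) + (\<integral>\<^sup>+t. h t \<partial>N)"
      using sum_list_nn_integral_mono_bounded_borel[of "[P', N']" "[P, N]", OF _ _ that] sets eq by auto
  qed
  have re: "(\<integral>t. u t \<partial>P) + (\<integral>t. u t \<partial>N) = (\<integral>t. u t \<partial>P') + (\<integral>t. u t \<partial>N')"
    if u: "integrable P u" "integrable N u" "integrable P' u" "integrable N' u" for u :: "real \<Rightarrow> real"
  proof -
    have "u \<in> borel_measurable P" using u by auto
    then have [measurable]: "u \<in> borel_measurable half_line"
      by (simp add: measurable_cong_sets[OF sets(1) refl])
    have fin: "(\<integral>\<^sup>+t. ennreal (u t) \<partial>M) < top" "(\<integral>\<^sup>+t. ennreal (- u t) \<partial>M) < top" if "integrable M u" for M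
      using that by (auto simp: real_integrable_def top.not_eq_extremum)
    have "enn2real (\<integral>\<^sup>+t. ennreal (u t) \<partial>P) + enn2real (\<integral>\<^sup>+t. ennreal (u t) \<partial>N)
        = enn2real (\<integral>\<^sup>+t. ennreal (u t) \<partial>P') + enn2real (\<integral>\<^sup>+t. ennreal (u t) \<partial>N')"
      using nn[of "\<lambda>t. ennreal (u t)"] u fin by (simp add: enn2real_plus[symmetric])
    moreover have "enn2real (\<integral>\<^sup>+t. ennreal (- u t) \<partial>P) + enn2real (\<integral>\<^sup>+t. ennreal (- u t) \<partial>N)
        = enn2real (\<integral>\<^sup>+t. ennreal (- u t) \<partial>P') + enn2real (\<integral>\<^sup>+t. ennreal (- u t) \<partial>N')"
      using nn[of "\<lambda>t. ennreal (- u t)"] u fin by (simp add: enn2real_plus[symmetric])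
    ultimately show ?thesis
      using u by (simp add: real_lebesgue_integral_def)
  qed
  show ?thesis
    using re[of "\<lambda>t. Re (g t)"] re[of "\<lambda>t. Im (g t)"] int by (simp add: complex_eq_iff)
qed

section \<open>Integrals against complex measures\<close>

lemma bounded_additive_measure:
  assumes "locally_finite P"
  shows "bounded_additive (measure P)"
  unfolding bounded_additive_def
proof (intro allI impI, elim conjE)
  fix A :: "nat \<Rightarrow> real set"
  assume A: "range A \<subseteq> bounded_borel" "disjoint_family A" "(\<Union>n. A n) \<in> bounded_borel"
  show "(\<lambda>n. measure P (A n)) sums measure P (\<Union>n. A n)"
    using A assms bounded_borel_half_line
    by (intro measure_UNION) (auto simp: locally_finite_def)
qed

lemma emeasure_upper_variation_le:
  assumes \<nu>: "bounded_additive \<nu>" and P: "locally_finite P"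
    and le: "\<And>A. A \<in> bounded_borel \<Longrightarrow> \<nu> A \<le> measure P A" and A: "A \<in> bounded_borel"
  shows "emeasure (upper_variation \<nu>) A \<le> emeasure P A"
  unfolding emeasure_upper_variation[OF \<nu> bounded_borel_half_line[OF A]]
proof (rule SUP_least)
  fix B assume "B \<in> {B \<in> bounded_borel. B \<subseteq> A}"
  then have B: "B \<in> bounded_borel" "B \<subseteq> A" by auto
  have "ennreal (\<nu> B) \<le> emeasure P B"
    using le[OF B(1)] locally_finite_emeasure[OF P B(1)] by (simp add: ennreal_leI)
  also have "\<dots> \<le> emeasure P A"
    using B A P by (intro emeasure_mono) (auto simp: locally_finite_sets bounded_borel_half_line)
  finally show "ennreal (\<nu> B) \<le> emeasure P A" .
qed

lemma integrable_mono_bounded_borel: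
  fixes g :: "real \<Rightarrow> complex"
  assumes "sets M = sets half_line" "sets P = sets half_line"
    and "\<And>A. A \<in> bounded_borel \<Longrightarrow> emeasure M A \<le> emeasure P A" "integrable P g"
  shows "integrable M g"
  unfolding integrable_iff_bounded
proof
  have m: "g \<in> borel_measurable half_line"
    using borel_measurable_integrable[OF assms(4)] by (simp add: measurable_cong_sets[OF assms(2) refl])
  then show "g \<in> borel_measurable M"
    by (simp add: measurable_cong_sets[OF assms(1) refl])
  have "(\<integral>\<^sup>+ x. ennreal (norm (g x)) \<partial>M) \<le> (\<integral>\<^sup>+ x. ennreal (norm (g x)) \<partial>P)"
    using sum_list_nn_integral_mono_bounded_borel[of "[M]" "[P]" "\<lambda>x. ennreal (norm (g x))"] assms m by auto
  also have "\<dots> < \<infinity>" using assms(4) by (simp add: integrable_iff_bounded)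
  finally show "(\<integral>\<^sup>+ x. ennreal (norm (g x)) \<partial>M) < \<infinity>" .
qed

text \<open>The integral against a signed measure may be computed from any decomposition \<open>\<nu> = P - N\<close>, not
  only from the minimal one: the variations of \<open>\<nu>\<close> lie below \<open>P\<close> and \<open>N\<close>, and
  \<open>\<nu>\<^sup>+ + N = P + \<nu>\<^sup>-\<close>.\<close>

lemma signed_integral_eq:
  assumes \<nu>: "bounded_additive \<nu>" and P: "locally_finite P" and N: "locally_finite N"
    and eq: "\<And>A. A \<in> bounded_borel \<Longrightarrow> \<nu> A = measure P A - measure N A"
    and g: "integrable P g" "integrable N g"
  shows "signed_integral g \<nu> = (\<integral>t. g t \<partial>P) - (\<integral>t. g t \<partial>N)"
proof -
  let ?U = "upper_variation \<nu>" and ?L = "upper_variation (\<lambda>A. - \<nu> A)"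
  have \<nu>': "bounded_additive (\<lambda>A. - \<nu> A)"
    by (rule bounded_additive_linear[OF \<nu> bounded_linear_minus[OF bounded_linear_ident]])
  have U: "emeasure ?U A \<le> emeasure P A" if "A \<in> bounded_borel" for A
    using \<nu> P _ that by (rule emeasure_upper_variation_le) (simp add: eq)
  have L: "emeasure ?L A \<le> emeasure N A" if "A \<in> bounded_borel" for A
    using \<nu>' N _ that by (rule emeasure_upper_variation_le) (simp add: eq)
  have lfU: "locally_finite ?U" and lfL: "locally_finite ?L"
    using U L P N unfolding locally_finite_def by (auto intro: le_less_trans[OF U] le_less_trans[OF L])
  have int: "integrable ?U g" "integrable ?L g"
    using integrable_mono_bounded_borel[OF _ locally_finite_sets[OF P] U g(1)]
      integrable_mono_bounded_borel[OF _ locally_finite_sets[OF N] L g(2)] by simp_all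
  have "(\<integral>t. g t \<partial>?U) + (\<integral>t. g t \<partial>N) = (\<integral>t. g t \<partial>P) + (\<integral>t. g t \<partial>?L)"
  proof (rule integral_add_cong_measure)
    fix A assume A: "A \<in> bounded_borel"
    have "\<nu> A = measure ?U A - measure ?L A"
      using \<nu> A lfU lfL by (intro jordan_decomposition) (auto simp: locally_finite_def)
    then have "measure ?U A + measure N A = measure P A + measure ?L A"
      using eq[OF A] by simp
    then show "emeasure ?U A + emeasure N A = emeasure P A + emeasure ?L A"
      using lfU lfL P N A by (simp add: locally_finite_emeasure flip: ennreal_plus)
  qed (use g int P N in \<open>auto simp: locally_finite_sets\<close>)
  then show ?thesis
    by (simp add: signed_integral_def algebra_simps)
qed

lemma sum_lessThan_4: "(\<Sum>k<4. f k) = f 0 + f 1 + f 2 + f (3::nat)"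
  by (simp add: eval_nat_numeral ac_simps)

lemma i_powers: "\<i> ^ 2 = -1" "\<i> ^ 3 = -\<i>" "(-\<i>) ^ 3 = \<i>"
  by (simp_all add: power3_eq_cube)

text \<open>Every locally finite complex measure has the form \<open>Q\<^sub>0 + \<i> Q\<^sub>1 - Q\<^sub>2 - \<i> Q\<^sub>3\<close> with positive locally
  finite measures, and the operator acts on the four parts separately. Indexing the parts by the
  powers of \<open>\<i>\<close> lets one formula treat them all.\<close>

definition complex_combination :: "(nat \<Rightarrow> real measure) \<Rightarrow> real set \<Rightarrow> complex"
  where "complex_combination Q A =
    (if A \<in> bounded_borel then \<Sum>k<4. \<i> ^ k * complex_of_real (measure (Q k) A) else 0)"

lemma bounded_additive_complex_combination:
  assumes "\<And>k. locally_finite (Q k)"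
  shows "bounded_additive (complex_combination Q)"
  unfolding bounded_additive_def
proof (intro allI impI, elim conjE)
  fix A :: "nat \<Rightarrow> real set"
  assume A: "range A \<subseteq> bounded_borel" "disjoint_family A" "(\<Union>n. A n) \<in> bounded_borel"
  have "(\<lambda>n. \<Sum>k<4. \<i> ^ k * complex_of_real (measure (Q k) (A n)))
      sums (\<Sum>k<4. \<i> ^ k * complex_of_real (measure (Q k) (\<Union>n. A n)))"
    using A bounded_additive_measure[OF assms]
    by (intro sums_sum sums_mult sums_of_real bounded_additiveD) auto
  then show "(\<lambda>n. complex_combination Q (A n)) sums complex_combination Q (\<Union>n. A n)"
    using A by (simp add: complex_combination_def range_subsetD)
qed

lemma complex_measure_integral_complex_combination:
  assumes Q: "\<And>k. locally_finite (Q k)" and g: "\<And>k. integrable (Q k) g"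
  shows "complex_measure_integral g (complex_combination Q) = (\<Sum>k<4. \<i> ^ k * (\<integral>t. g t \<partial>Q k))"
proof -
  have b: "bounded_additive (complex_combination Q)"
    using Q by (rule bounded_additive_complex_combination)
  have re: "signed_integral g (\<lambda>A. Re (complex_combination Q A)) = (\<integral>t. g t \<partial>Q 0) - (\<integral>t. g t \<partial>Q 2)"
    using bounded_additive_linear[OF b bounded_linear_Re] Q Q _ g g
    by (rule signed_integral_eq) (simp add: complex_combination_def sum_lessThan_4 i_powers)
  have im: "signed_integral g (\<lambda>A. Im (complex_combination Q A)) = (\<integral>t. g t \<partial>Q 1) - (\<integral>t. g t \<partial>Q 3)"
    using bounded_additive_linear[OF b bounded_linear_Im] Q Q _ g g
    by (rule signed_integral_eq) (simp add: complex_combination_def sum_lessThan_4 i_powers)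
  show ?thesis
    by (simp add: complex_measure_integral_def re im sum_lessThan_4 i_powers algebra_simps)
qed

text \<open>The total variation is at most \<open>Q\<^sub>0 + Q\<^sub>1 + Q\<^sub>2 + Q\<^sub>3\<close>, as the coefficients have modulus one.\<close>

lemma complex_combination_in_weighted_measures:
  assumes Q: "\<And>k. locally_finite (Q k)"
    and \<omega>: "continuous_on {0..} \<omega>" and fin: "\<And>k. (\<integral>\<^sup>+ t. ennreal (\<omega> t) \<partial>Q k) < \<infinity>"
  shows "complex_combination Q \<in> weighted_measures \<omega>"
proof -
  let ?\<nu> = "complex_combination Q"
  have b: "bounded_additive ?\<nu>"
    using Q by (rule bounded_additive_complex_combination)
  have "emeasure (total_variation ?\<nu>) A \<le> (\<Sum>k<4. emeasure (Q k) A)" if A: "A \<in> bounded_borel" for A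
    unfolding emeasure_total_variation[OF b bounded_borel_half_line[OF A]]
  proof (rule SUP_least)
    fix E assume "E \<in> bounded_partitions A"
    then have E: "E n \<in> bounded_borel" "disjoint_family E" "(\<Union>n. E n) = A" for n by auto
    have "ennreal (cmod (?\<nu> (E n))) \<le> (\<Sum>k<4. emeasure (Q k) (E n))" for n
    proof -
      have "cmod (?\<nu> (E n)) \<le> (\<Sum>k<4. cmod (\<i> ^ k * complex_of_real (measure (Q k) (E n))))"
        using E(1) by (simp add: complex_combination_def norm_sum del: norm_mult)
      also have "\<dots> = (\<Sum>k<4. measure (Q k) (E n))"
        by (simp add: norm_mult norm_power)
      finally have "ennreal (cmod (?\<nu> (E n))) \<le> ennreal (\<Sum>k<4. measure (Q k) (E n))"
        by (rule ennreal_leI)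
      also have "\<dots> = (\<Sum>k<4. emeasure (Q k) (E n))"
        using locally_finite_emeasure[OF Q E(1)] by (simp add: sum_ennreal)
      finally show ?thesis .
    qed
    then have "(\<Sum>n. ennreal (cmod (?\<nu> (E n)))) \<le> (\<Sum>n. \<Sum>k<4. emeasure (Q k) (E n))"
      by (intro suminf_le) auto
    also have "\<dots> = (\<Sum>k<4. \<Sum>n. emeasure (Q k) (E n))"
      by (intro suminf_sum) auto
    also have "\<dots> = (\<Sum>k<4. emeasure (Q k) A)"
      using E locally_finite_sets[OF Q] bounded_borel_half_line
      by (intro sum.cong refl) (subst suminf_emeasure, auto)
    finally show "(\<Sum>n. ennreal (cmod (?\<nu> (E n)))) \<le> (\<Sum>k<4. emeasure (Q k) A)" .
  qed
  moreover have "(\<lambda>t. ennreal (\<omega> t)) \<in> borel_measurable half_line"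
    using borel_measurable_continuous_on_restrict[OF \<omega>] by measurable
  ultimately have "(\<Sum>M\<leftarrow>[total_variation ?\<nu>]. \<integral>\<^sup>+ t. ennreal (\<omega> t) \<partial>M)
      \<le> (\<Sum>M\<leftarrow>map Q [0..<4]. \<integral>\<^sup>+ t. ennreal (\<omega> t) \<partial>M)"
    using locally_finite_sets[OF Q]
    by (intro sum_list_nn_integral_mono_bounded_borel)
      (auto simp: interv_sum_list_conv_sum_set_nat atLeast0LessThan comp_def simp del: upt_Suc upt_rec_numeral)
  then have "(\<integral>\<^sup>+ t. ennreal (\<omega> t) \<partial>total_variation ?\<nu>) \<le> (\<Sum>k<4. \<integral>\<^sup>+ t. ennreal (\<omega> t) \<partial>Q k)"
    by (simp add: interv_sum_list_conv_sum_set_nat atLeast0LessThan comp_def del: upt_Suc upt_rec_numeral)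
  also have "\<dots> < \<infinity>" using fin by simp
  finally show ?thesis
    using b by (simp add: weighted_measures_def loc_finite_complex_measure_iff complex_combination_def)
qed

text \<open>The four parts are the upper variations of the real parts of \<open>\<mu>\<close>, \<open>-\<i>\<mu>\<close>, \<open>-\<mu>\<close> and \<open>\<i>\<mu>\<close>.
  For this choice the formula for the integral is the definition, so it holds for every \<open>g\<close>.\<close>

lemma weighted_measures_eq_complex_combination:
  assumes \<mu>: "\<mu> \<in> weighted_measures \<omega>"
    and \<omega>: "continuous_on {0..} \<omega>" "\<And>t. 0 \<le> t \<Longrightarrow> 0 < \<omega> t"
  obtains P where "\<And>k. locally_finite (P k)" "\<And>k. (\<integral>\<^sup>+ t. ennreal (\<omega> t) \<partial>P k) < \<infinity>"
    "\<mu> = complex_combination P"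
    "\<And>g. complex_measure_integral g \<mu> = (\<Sum>k<4. \<i> ^ k * (\<integral>t. g t \<partial>P k))"
proof -
  have b: "bounded_additive \<mu>" and off: "\<And>A. A \<notin> bounded_borel \<Longrightarrow> \<mu> A = 0"
    and fin: "(\<integral>\<^sup>+ t. ennreal (\<omega> t) \<partial>total_variation \<mu>) < \<infinity>"
    using \<mu> by (auto simp: weighted_measures_def loc_finite_complex_measure_iff)
  define P where "P k = upper_variation (\<lambda>A. Re ((-\<i>) ^ k * \<mu> A))" for k
  have z: "cmod ((-\<i>) ^ k) = 1" for k by (simp add: norm_power)
  have finP: "(\<integral>\<^sup>+ t. ennreal (\<omega> t) \<partial>P k) < \<infinity>" for k
  proof -
    have "(\<lambda>t. ennreal (\<omega> t)) \<in> borel_measurable half_line"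
      using borel_measurable_continuous_on_restrict[OF \<omega>(1)] by measurable
    then have "(\<Sum>M\<leftarrow>[P k]. \<integral>\<^sup>+ t. ennreal (\<omega> t) \<partial>M) \<le> (\<Sum>M\<leftarrow>[total_variation \<mu>]. \<integral>\<^sup>+ t. ennreal (\<omega> t) \<partial>M)"
      using emeasure_upper_variation_Re_le_total_variation[OF b z[of k]]
      by (intro sum_list_nn_integral_mono_measure[where L = half_line]) (auto simp: P_def)
    then have "(\<integral>\<^sup>+ t. ennreal (\<omega> t) \<partial>P k) \<le> (\<integral>\<^sup>+ t. ennreal (\<omega> t) \<partial>total_variation \<mu>)" by simp
    then show ?thesis using fin by (rule le_less_trans)
  qed
  have lf: "locally_finite (P k)" for k
    using _ \<omega> finP by (rule locally_finite_if_weight_integrable) (simp add: P_def)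
  have P: "P 0 = upper_variation (\<lambda>A. Re (\<mu> A))" "P 1 = upper_variation (\<lambda>A. Im (\<mu> A))"
    "P 2 = upper_variation (\<lambda>A. - Re (\<mu> A))" "P 3 = upper_variation (\<lambda>A. - Im (\<mu> A))"
    by (simp_all add: P_def i_powers)
  have J: "Re (\<mu> A) = measure (P 0) A - measure (P 2) A" "Im (\<mu> A) = measure (P 1) A - measure (P 3) A"
    if A: "A \<in> bounded_borel" for A
    using jordan_decomposition[OF bounded_additive_linear[OF b bounded_linear_Re] A]
      jordan_decomposition[OF bounded_additive_linear[OF b bounded_linear_Im] A]
      lf[of 0] lf[of 1] lf[of 2] lf[of 3] A
    by (auto simp: P P[simplified] locally_finite_def)
  show ?thesis
  proof (rule that[of P])
    show "\<mu> = complex_combination P"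
      using off J by (auto simp: fun_eq_iff complex_combination_def complex_eq_iff sum_lessThan_4 i_powers)
    show "complex_measure_integral g \<mu> = (\<Sum>k<4. \<i> ^ k * (\<integral>t. g t \<partial>P k))" for g
      by (simp add: complex_measure_integral_def signed_integral_def sum_lessThan_4 i_powers P[simplified] algebra_simps)
  qed (rule lf finP)+
qed

section \<open>Uniqueness of the representing measure\<close>

text \<open>On each interval \<open>{0..c}\<close> the agreement of the two set functions is a Dynkin property, and the
  sets \<open>{..a}\<close> form an intersection-stable generator of the Borel sets.\<close>

lemma loc_finite_complex_measure_eqI:
  assumes \<mu>: "loc_finite_complex_measure \<mu>" and \<nu>: "loc_finite_complex_measure \<nu>"
    and eq: "\<And>a. 0 \<le> a \<Longrightarrow> \<mu> {0..a} = \<nu> {0..a}"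
  shows "\<mu> = \<nu>"
proof
  fix A
  have b: "bounded_additive \<mu>" "bounded_additive \<nu>"
    using \<mu> \<nu> by (simp_all add: loc_finite_complex_measure_iff)
  show "\<mu> A = \<nu> A"
  proof (cases "A \<in> bounded_borel")
    case True
    obtain c where c: "0 \<le> c" "A \<subseteq> {0..c}" using bounded_borel_subset_interval[OF True] by blast
    have I: "B \<inter> {0..c} \<in> bounded_borel" if "B \<in> sets borel" for B
      by (rule bounded_borel_subset[OF bounded_borel_atLeastAtMost[of 0 c]]) (use that in auto)
    have "A \<in> sets borel" using True by (simp add: bounded_borel_def)
    then have A: "A \<in> sigma_sets UNIV (range (\<lambda>a::real. {..a}))"
      by (simp add: borel_eq_atMost)
    have "Int_stable (range (\<lambda>a::real. {..a}))" by (auto simp: Int_stable_def)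
    then have "\<mu> (A \<inter> {0..c}) = \<nu> (A \<inter> {0..c})"
      using subset_UNIV[of "range (\<lambda>a::real. {..a})", folded Pow_UNIV] A
    proof (induction rule: sigma_sets_induct_disjoint)
      case (basic B)
      then obtain a where B: "B = {..a}" by blast
      show ?case
      proof (cases "0 \<le> a")
        case True
        then have "B \<inter> {0..c} = {0..min a c}" using B by auto
        then show ?thesis using eq[of "min a c"] True c(1) by simp
      next
        case False
        then have "B \<inter> {0..c} = {}" using B by auto
        then show ?thesis by (simp add: bounded_additive_empty[OF b(1)] bounded_additive_empty[OF b(2)])
      qed
    next
      case empty
      then show ?case by (simp add: bounded_additive_empty[OF b(1)] bounded_additive_empty[OF b(2)])
    next
      case (compl B)
      then have "B \<in> sets borel" by (simp add: borel_eq_atMost)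
      then have B: "B \<inter> {0..c} \<in> bounded_borel" by (rule I)
      have C: "(UNIV - B) \<inter> {0..c} = {0..c} - B \<inter> {0..c}" by blast
      show ?case
        unfolding C using compl eq[OF c(1)] bounded_borel_atLeastAtMost[of 0 c] B
        by (simp add: bounded_additive_Diff[OF b(1)] bounded_additive_Diff[OF b(2)])
    next
      case (union B)
      then have B: "B i \<in> sets borel" for i by (auto simp: borel_eq_atMost)
      have U: "(\<Union>i. B i \<inter> {0..c}) = (\<Union>i. B i) \<inter> {0..c}" by blast
      have "(\<lambda>i. m (B i \<inter> {0..c})) sums m (\<Union>i. B i \<inter> {0..c})"
        if "bounded_additive m" for m :: "real set \<Rightarrow> complex"
      proof (rule bounded_additiveD[OF that])
        show "(\<Union>i. B i \<inter> {0..c}) \<in> bounded_borel" unfolding U using B by (intro I) auto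
        show "disjoint_family (\<lambda>i. B i \<inter> {0..c})"
          using union(1) by (auto simp: disjoint_family_on_def)
      qed (use B I in auto)
      from this[OF b(1)] this[OF b(2)] union show ?case
        unfolding U by (simp add: sums_iff)
    qed
    then show ?thesis using c(2) by (simp add: Int_absorb2)
  next
    case False
    then show ?thesis using \<mu> \<nu> by (simp add: loc_finite_complex_measure_iff)
  qed
qed

text \<open>A continuous function with compact support in the half-line; as \<open>n\<close> grows it decreases to the
  indicator of \<open>{..a}\<close>. The slope \<open>Suc n\<close> keeps it zero beyond \<open>a + 1\<close> also for \<open>n = 0\<close>, which
  yields one dominating function for all \<open>n\<close>.\<close>

definition plateau :: "real \<Rightarrow> nat \<Rightarrow> real \<Rightarrow> real"
  where "plateau a n t = max 0 (min 1 (1 - real (Suc n) * (t - a)))"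

lemma plateau_in_weighted_C0: "(\<lambda>t. complex_of_real (plateau a n t)) \<in> weighted_C0 \<omega>"
proof -
  have "\<forall>\<^sub>F t in at_top. complex_of_real (plateau a n t) / complex_of_real (\<omega> t) = 0"
    using eventually_ge_at_top[of "a + 1"]
  proof eventually_elim
    case (elim t)
    then have "1 * 1 \<le> real (Suc n) * (t - a)" by (intro mult_mono) auto
    then show ?case by (simp add: plateau_def)
  qed
  moreover have "continuous_on {0..} (\<lambda>t. complex_of_real (plateau a n t))"
    unfolding plateau_def by (intro continuous_intros)
  ultimately show ?thesis
    by (simp add: weighted_C0_def tendsto_eventually)
qed

lemma integral_plateau_tendsto:
  assumes P: "locally_finite P" and a: "0 \<le> a"
  shows "(\<lambda>n. \<integral>t. complex_of_real (plateau a n t) \<partial>P) \<longlonglongrightarrow> complex_of_real (measure P {0..a})"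
proof -
  have [measurable_cong]: "sets P = sets half_line" by (rule locally_finite_sets[OF P])
  have sp: "space P = {0..}" by (rule locally_finite_space[OF P])
  have meas: "plateau a n \<in> borel_measurable P" for n
  proof -
    have "continuous_on UNIV (plateau a n)"
      unfolding plateau_def by (intro continuous_intros)
    then have "plateau a n \<in> borel_measurable borel" by (rule borel_measurable_continuous_onI)
    then show ?thesis
      unfolding measurable_cong_sets[OF locally_finite_sets[OF P] refl] by (rule measurable_restrict_space1)
  qed
  have S: "{0..b} \<in> sets P" "emeasure P {0..b} < \<infinity>" for b
    using P bounded_borel_atLeastAtMost[of 0 b] by (auto simp: locally_finite_def sets_half_line)
  have "(\<lambda>n. \<integral>t. plateau a n t \<partial>P) \<longlonglongrightarrow> (\<integral>t. indicator {0..a} t \<partial>P)"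
  proof (rule integral_dominated_convergence[where w = "indicator {0..a + 1}"])
    show "integrable P (indicator {0..a + 1} :: real \<Rightarrow> real)"
      using S by (simp add: integrable_indicator_iff)
    show "(indicator {0..a} :: real \<Rightarrow> real) \<in> borel_measurable P" using S by simp
    show "AE t in P. (\<lambda>n. plateau a n t) \<longlonglongrightarrow> indicator {0..a} t"
    proof (rule AE_I2)
      fix t assume "t \<in> space P"
      then have t: "0 \<le> t" using sp by simp
      show "(\<lambda>n. plateau a n t) \<longlonglongrightarrow> indicator {0..a} t"
      proof (cases "t \<le> a")
        case True
        then have "real (Suc n) * (t - a) \<le> 0" for n by (intro mult_nonneg_nonpos) auto
        then have "plateau a n t = 1" for n by (simp add: plateau_def min_def)
        then show ?thesis using True t by simp
      next
        case False
        then obtain N where N: "1 / (t - a) < real N" using reals_Archimedean2 by blast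
        have "plateau a n t = 0" if "n \<ge> N" for n
        proof -
          have "1 / (t - a) \<le> real (Suc n)" using N that by simp
          then have "1 \<le> real (Suc n) * (t - a)" using False by (simp add: field_simps)
          then show ?thesis by (simp add: plateau_def)
        qed
        then have "\<forall>\<^sub>F n in sequentially. plateau a n t = 0"
          unfolding eventually_sequentially by blast
        then show ?thesis using False by (simp add: tendsto_eventually)
      qed
    qed
    show "AE t in P. norm (plateau a n t) \<le> indicator {0..a + 1} t" for n
    proof (rule AE_I2)
      fix t assume "t \<in> space P"
      then have t: "0 \<le> t" using sp by simp
      show "norm (plateau a n t) \<le> indicator {0..a + 1} t"
      proof (cases "t \<le> a + 1")
        case False
        then have "1 * 1 \<le> real (Suc n) * (t - a)" by (intro mult_mono) auto
        then show ?thesis by (simp add: plateau_def)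
      qed (use t in \<open>simp add: plateau_def\<close>)
    qed
  qed (rule meas)
  moreover have "(\<integral>t. indicator {0..a} t \<partial>P) = measure P {0..a}"
    using S sp by (simp add: Int_absorb2)
  ultimately show ?thesis
    by (simp add: tendsto_of_real)
qed

text \<open>The uniqueness half of the duality between \<open>C\<^sub>0(1/\<omega>)\<close> and \<open>M(\<omega>)\<close>: the integrals of the plateau
  functions converge to the values on the intervals \<open>{0..a}\<close>.\<close>

lemma complex_measure_integral_determines:
  assumes \<omega>: "continuous_on {0..} \<omega>" "\<And>t. 0 \<le> t \<Longrightarrow> 0 < \<omega> t"
    and \<mu>: "\<mu> \<in> weighted_measures \<omega>" and \<nu>: "\<nu> \<in> weighted_measures \<omega>"
    and eq: "\<And>g. g \<in> weighted_C0 \<omega> \<Longrightarrow> complex_measure_integral g \<mu> = complex_measure_integral g \<nu>"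
  shows "\<mu> = \<nu>"
proof (rule loc_finite_complex_measure_eqI)
  show "loc_finite_complex_measure \<mu>" "loc_finite_complex_measure \<nu>"
    using \<mu> \<nu> by (auto simp: weighted_measures_def)
  fix a :: real assume a: "0 \<le> a"
  let ?g = "\<lambda>n t. complex_of_real (plateau a n t)"
  have lim: "(\<lambda>n. complex_measure_integral (?g n) m) \<longlonglongrightarrow> m {0..a}"
    if m: "m \<in> weighted_measures \<omega>" for m
  proof -
    obtain P where P: "\<And>k. locally_finite (P k)" "m = complex_combination P"
      "\<And>g. complex_measure_integral g m = (\<Sum>k<4. \<i> ^ k * (\<integral>t. g t \<partial>P k))"
      using weighted_measures_eq_complex_combination[OF m \<omega>] by metis
    have "(\<lambda>n. \<Sum>k<4. \<i> ^ k * (\<integral>t. ?g n t \<partial>P k))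
        \<longlonglongrightarrow> (\<Sum>k<4. \<i> ^ k * complex_of_real (measure (P k) {0..a}))"
      by (intro tendsto_intros integral_plateau_tendsto P a)
    moreover have "m {0..a} = (\<Sum>k<4. \<i> ^ k * complex_of_real (measure (P k) {0..a}))"
      using bounded_borel_atLeastAtMost[of 0 a] by (simp add: P(2) complex_combination_def)
    ultimately show ?thesis by (simp only: P(3))
  qed
  have "complex_measure_integral (?g n) \<mu> = complex_measure_integral (?g n) \<nu>" for n
    by (rule eq[OF plateau_in_weighted_C0])
  with lim[OF \<mu>] lim[OF \<nu>] show "\<mu> {0..a} = \<nu> {0..a}"
    by (simp add: LIMSEQ_unique)
qed

section \<open>The operator on positive measures\<close>

text \<open>The measure \<open>\<phi>(t)/t dt\<close> on \<open>(0,1]\<close>. The point \<open>0\<close>, where \<open>s/t\<close> makes no sense, is left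
  out.\<close>

definition cesaro_weight :: "(real \<Rightarrow> real) \<Rightarrow> real measure"
  where "cesaro_weight \<phi> = density (restrict_space lborel {0<..1}) (\<lambda>t. ennreal (\<phi> t / t))"

text \<open>The extended operator on positive measures: it is dual to \<open>g \<mapsto> (s \<mapsto> \<integral> g(s/t) \<phi>(t)/t dt)\<close>.\<close>

definition cesaro_image :: "(real \<Rightarrow> real) \<Rightarrow> real measure \<Rightarrow> real measure"
  where "cesaro_image \<phi> P = distr (P \<Otimes>\<^sub>M cesaro_weight \<phi>) half_line (\<lambda>(s, t). s / t)"

lemma sets_cesaro_weight [simp, measurable_cong]:
  "sets (cesaro_weight \<phi>) = sets (restrict_space borel {0<..1})"
  by (simp add: cesaro_weight_def sets_restrict_space)

lemma space_cesaro_weight [simp]: "space (cesaro_weight \<phi>) = {0<..1}"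
  by (simp add: cesaro_weight_def space_restrict_space)

lemma sets_cesaro_image [simp, measurable_cong]: "sets (cesaro_image \<phi> P) = sets half_line"
  by (simp add: cesaro_image_def)

lemma borel_measurable_cesaro_weight:
  "f \<in> borel_measurable borel \<Longrightarrow> f \<in> borel_measurable (cesaro_weight \<phi>)"
  by (simp add: measurable_cong_sets[OF sets_cesaro_weight refl] measurable_restrict_space1)

lemma nn_integral_cesaro_weight:
  assumes [measurable]: "\<phi> \<in> borel_measurable borel" "h \<in> borel_measurable borel"
  shows "(\<integral>\<^sup>+ t. h t \<partial>cesaro_weight \<phi>)
    = (\<integral>\<^sup>+ t. ennreal (\<phi> t / t) * h t * indicator {0<..1} t \<partial>lborel)"
proof -
  have r: "f \<in> borel_measurable (restrict_space lborel {0<..1})" if "f \<in> borel_measurable borel"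
    for f :: "real \<Rightarrow> ennreal"
    using that by (intro measurable_restrict_space1) simp
  show ?thesis
    unfolding cesaro_weight_def
    by (subst nn_integral_density) (auto intro!: r simp: nn_integral_restrict_space)
qed

lemma measurable_quotient:
  assumes "sets P = sets half_line"
  shows "(\<lambda>(s, t). s / t) \<in> measurable (P \<Otimes>\<^sub>M cesaro_weight \<phi>) half_line"
proof (rule measurable_restrict_space2)
  have [simp]: "space P = {0..}" using sets_eq_imp_space_eq[OF assms] by (simp add: space_restrict_space)
  show "(\<lambda>(s, t). s / t) \<in> space (P \<Otimes>\<^sub>M cesaro_weight \<phi>) \<rightarrow> {0..}"
    by (auto simp: space_pair_measure)
  have [measurable]: "(\<lambda>s. s) \<in> borel_measurable P"
    unfolding measurable_cong_sets[OF assms refl] by (rule measurable_restrict_space1) simp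
  have [measurable]: "(\<lambda>t. t) \<in> borel_measurable (cesaro_weight \<phi>)"
    by (rule borel_measurable_cesaro_weight) simp
  show "(\<lambda>(s, t). s / t) \<in> borel_measurable (P \<Otimes>\<^sub>M cesaro_weight \<phi>)"
    by measurable
qed

lemma nn_integral_cesaro_image:
  assumes P: "sets P = sets half_line" and D: "finite_measure (cesaro_weight \<phi>)"
    and h: "h \<in> borel_measurable half_line"
  shows "(\<integral>\<^sup>+ y. h y \<partial>cesaro_image \<phi> P) = (\<integral>\<^sup>+ s. \<integral>\<^sup>+ t. h (s / t) \<partial>cesaro_weight \<phi> \<partial>P)"
proof -
  interpret D: finite_measure "cesaro_weight \<phi>" by (rule D)
  note m = measurable_quotient[OF P, of \<phi>]
  have "(\<integral>\<^sup>+ y. h y \<partial>cesaro_image \<phi> P) = (\<integral>\<^sup>+ z. h (case z of (s, t) \<Rightarrow> s / t) \<partial>(P \<Otimes>\<^sub>M cesaro_weight \<phi>))"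
    unfolding cesaro_image_def using h by (intro nn_integral_distr[OF m]) simp
  also have "\<dots> = (\<integral>\<^sup>+ s. \<integral>\<^sup>+ t. h (s / t) \<partial>cesaro_weight \<phi> \<partial>P)"
    using D.nn_integral_fst[OF measurable_compose[OF m h]] by simp
  finally show ?thesis .
qed

lemma integral_cesaro_image:
  fixes g :: "real \<Rightarrow> complex"
  assumes P: "locally_finite P" and D: "finite_measure (cesaro_weight \<phi>)"
    and g: "integrable (cesaro_image \<phi> P) g"
  shows "(\<integral> y. g y \<partial>cesaro_image \<phi> P) = (\<integral> s. \<integral> t. g (s / t) \<partial>cesaro_weight \<phi> \<partial>P)"
proof -
  interpret P: sigma_finite_measure P by (rule sigma_finite_locally_finite[OF P])
  interpret D: finite_measure "cesaro_weight \<phi>" by (rule D)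
  interpret pair_sigma_finite P "cesaro_weight \<phi>" ..
  note m = measurable_quotient[OF locally_finite_sets[OF P], of \<phi>]
  have gm: "g \<in> borel_measurable half_line"
    using borel_measurable_integrable[OF g] by (simp add: measurable_cong_sets[OF sets_cesaro_image refl])
  have "integrable (P \<Otimes>\<^sub>M cesaro_weight \<phi>) (\<lambda>z. g (case z of (s, t) \<Rightarrow> s / t))"
    using g unfolding cesaro_image_def by (simp add: integrable_distr_eq[OF m gm])
  from integral_fst'[OF this] show ?thesis
    unfolding cesaro_image_def by (simp add: integral_distr[OF m gm])
qed

text \<open>The preimage is contained in the image of \<open>A\<close> under \<open>y \<mapsto> s/y\<close>, which is differentiable away
  from \<open>0\<close>.\<close>

lemma negligible_quotient_preimage:
  fixes s :: real
  assumes "negligible A" "A \<subseteq> {0<..}"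
  shows "negligible {t. s / t \<in> A}"
proof (rule negligible_subset)
  have "(\<lambda>y. s / y) differentiable_on A"
    unfolding differentiable_on_def using assms(2) by (intro ballI differentiable_divide) auto
  then show "negligible ((\<lambda>y. s / y) ` A)"
    using assms(1) by (intro negligible_differentiable_image_negligible) auto
  show "{t. s / t \<in> A} \<subseteq> (\<lambda>y. s / y) ` A"
  proof
    fix t assume t: "t \<in> {t. s / t \<in> A}"
    then have "0 < s / t" using assms(2) by auto
    then have "s \<noteq> 0" "t \<noteq> 0" by auto
    then have "t = s / (s / t)" by simp
    then show "t \<in> (\<lambda>y. s / y) ` A" using t by blast
  qed
qed

text \<open>The smoothing effect of the operator. By Fubini the value of the image measure on \<open>A\<close> is an
  average over \<open>s\<close> of the weights of the sets \<open>{t. s/t \<in> A}\<close>, all of which are Lebesgue null.\<close>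

lemma null_set_cesaro_image:
  assumes P: "sets P = sets half_line" and D: "finite_measure (cesaro_weight \<phi>)"
    and \<phi>: "\<phi> \<in> borel_measurable borel"
    and A: "A \<in> null_sets lborel" "A \<subseteq> {0<..}"
  shows "emeasure (cesaro_image \<phi> P) A = 0"
proof -
  have [measurable]: "A \<in> sets borel" using A(1) by auto
  have AH: "A \<in> sets half_line" using A by (auto simp: sets_half_line)
  have neg: "negligible A"
    using A(1) by (simp add: negligible_iff_null_sets null_sets_completionI)
  have "(\<integral>\<^sup>+ t. indicator A (s / t) \<partial>cesaro_weight \<phi>) = 0" for s
  proof -
    have "{t. s / t \<in> A} \<in> null_sets lebesgue"
      using negligible_quotient_preimage[OF neg A(2)] by (simp add: negligible_iff_null_sets)
    then have "AE t in lebesgue. s / t \<notin> A"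
      by (intro AE_I') auto
    then have ae: "AE t in lborel. s / t \<notin> A" by (simp add: AE_completion_iff)
    have "(\<lambda>t. indicator A (s / t) :: ennreal) \<in> borel_measurable borel" by measurable
    then have "(\<integral>\<^sup>+ t. indicator A (s / t) \<partial>cesaro_weight \<phi>)
        = (\<integral>\<^sup>+ t. ennreal (\<phi> t / t) * indicator A (s / t) * indicator {0<..1} t \<partial>lborel)"
      by (rule nn_integral_cesaro_weight[OF \<phi>])
    also have "\<dots> = (\<integral>\<^sup>+ t. 0 \<partial>(lborel :: real measure))"
      using ae by (intro nn_integral_cong_AE) auto
    finally show ?thesis by simp
  qed
  then have "(\<integral>\<^sup>+ y. indicator A y \<partial>cesaro_image \<phi> P) = 0"
    using AH by (subst nn_integral_cesaro_image[OF P D]) auto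
  then show ?thesis using AH by simp
qed

section \<open>Density and atom at the origin\<close>

text \<open>Radon-Nikodym on the open half-line; the point \<open>0\<close> contributes an atom. The last property
  transfers the integrability of a weight from \<open>Q\<close> to the density.\<close>

lemma density_plus_atom_decomposition:
  assumes Q: "locally_finite Q"
    and null: "\<And>A. A \<in> null_sets lborel \<Longrightarrow> A \<subseteq> {0<..} \<Longrightarrow> emeasure Q A = 0"
  obtains f :: "real \<Rightarrow> real" where "f \<in> borel_measurable borel" "\<And>t. 0 \<le> f t"
    "\<And>A. A \<in> bounded_borel \<Longrightarrow> integrable (lebesgue_on A) f"
    "\<And>A. A \<in> bounded_borel \<Longrightarrow>
      measure Q A = (\<integral>t. f t \<partial>lebesgue_on A) + (if 0 \<in> A then measure Q {0} else 0)"
    "\<And>h :: real \<Rightarrow> ennreal. h \<in> borel_measurable borel \<Longrightarrow> (\<integral>\<^sup>+ t. f t * h t \<partial>lborel) \<le> (\<integral>\<^sup>+ t. h t \<partial>Q)"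
proof -
  have sQ [simp, measurable_cong]: "sets Q = sets half_line" by (rule locally_finite_sets[OF Q])
  have spQ: "space Q = {0..}" by (rule locally_finite_space[OF Q])
  have idm: "(\<lambda>t. t) \<in> measurable (density Q (indicator {0<..})) lborel"
    by (simp add: measurable_cong_sets[OF sQ refl] measurable_restrict_space1)
  have pos: "(indicator {0<..} :: real \<Rightarrow> ennreal) \<in> borel_measurable Q"
    unfolding measurable_cong_sets[OF sQ refl] by (rule measurable_restrict_space1) simp
  \<comment> \<open>The part of \<open>Q\<close> on the open half-line, as a measure on the whole line, so that it can be
    compared with Lebesgue measure directly.\<close>
  define N where "N = distr (density Q (indicator {0<..})) lborel (\<lambda>t. t)"
  have nnN: "(\<integral>\<^sup>+ t. h t \<partial>N) = (\<integral>\<^sup>+ t. indicator {0<..} t * h t \<partial>Q)"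
    if "h \<in> borel_measurable borel" for h
  proof -
    have "h \<in> borel_measurable Q"
      unfolding measurable_cong_sets[OF sQ refl] using that by (rule measurable_restrict_space1)
    then show ?thesis
      unfolding N_def using idm pos that by (simp add: nn_integral_distr nn_integral_density)
  qed
  have emN: "emeasure N A = emeasure Q (A \<inter> {0<..})" if A: "A \<in> sets borel" for A
  proof -
    have "emeasure N A = (\<integral>\<^sup>+ t. indicator A t \<partial>N)" using A by (simp add: N_def)
    also have "\<dots> = (\<integral>\<^sup>+ t. indicator (A \<inter> {0<..}) t \<partial>Q)"
      using A by (subst nnN) (auto simp: indicator_def intro!: nn_integral_cong)
    also have "\<dots> = emeasure Q (A \<inter> {0<..})"
      using A by (intro nn_integral_indicator) (auto simp: sets_half_line)
    finally show ?thesis .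
  qed
  have "absolutely_continuous lborel N"
    unfolding absolutely_continuous_def
  proof
    fix A :: "real set" assume A: "A \<in> null_sets lborel"
    then have "A \<inter> {0<..} \<in> null_sets lborel" by (intro null_set_Int2) auto
    then have "emeasure Q (A \<inter> {0<..}) = 0" by (rule null) auto
    moreover have "A \<in> sets borel" using A by auto
    ultimately show "A \<in> null_sets N"
      using emN by (auto simp: null_sets_def N_def)
  qed
  then obtain F where F [measurable]: "F \<in> borel_measurable lborel" and FN: "density lborel F = N"
    using sigma_finite_measure.Radon_Nikodym[OF sigma_finite_lborel, of N] by (auto simp: N_def)
  have FA: "(\<integral>\<^sup>+ t. F t * indicator A t \<partial>lborel) = emeasure Q (A \<inter> {0<..})" if "A \<in> sets borel" for A
    using that emN[OF that] FN by (metis F emeasure_density sets_lborel)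
  \<comment> \<open>Local finiteness makes the density finite almost everywhere, so that it can be taken
    real-valued.\<close>
  have "AE t in lborel. F t * indicator {..real n} t \<noteq> \<infinity>" for n
  proof (rule nn_integral_PInf_AE)
    have "{..real n} \<inter> {0<..} \<in> bounded_borel"
      by (rule bounded_borel_subset[OF bounded_borel_atLeastAtMost[of 0 "real n"]]) auto
    then show "(\<integral>\<^sup>+ t. F t * indicator {..real n} t \<partial>lborel) \<noteq> \<infinity>"
      using Q by (subst FA) (auto simp: locally_finite_def)
  qed simp
  then have "AE t in lborel. \<forall>n. F t * indicator {..real n} t \<noteq> \<infinity>"
    by (simp add: AE_all_countable)
  then have Ff: "AE t in lborel. F t = ennreal (enn2real (F t))"
  proof eventually_elim
    case (elim t)
    obtain n where "t \<le> real n" using real_arch_simple by blast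
    then have "F t \<noteq> \<infinity>" using elim[rule_format, of n] by simp
    then show ?case by (simp add: less_top)
  qed
  define f where "f t = enn2real (F t)" for t
  have fm [measurable]: "f \<in> borel_measurable borel" unfolding f_def using F by simp
  have f0: "0 \<le> f t" for t by (simp add: f_def)
  have fI: "(\<integral>\<^sup>+ t. ennreal (f t) * h t \<partial>lborel) = (\<integral>\<^sup>+ t. F t * h t \<partial>lborel)" for h
    using Ff by (intro nn_integral_cong_AE) (auto simp: f_def)
  have fA: "integrable lborel (\<lambda>t. indicator A t * f t) \<and>
      (\<integral>t. indicator A t * f t \<partial>lborel) = measure Q (A \<inter> {0<..})"
    if A: "A \<in> bounded_borel" for A
  proof -
    have Ab [measurable]: "A \<in> sets borel" using A by (simp add: bounded_borel_def)
    have "A \<inter> {0<..} \<in> bounded_borel" using A by (rule bounded_borel_subset) auto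
    then have "(\<integral>\<^sup>+ t. ennreal (indicator A t * f t) \<partial>lborel) = ennreal (measure Q (A \<inter> {0<..}))"
      using fI[of "indicator A"] FA[OF Ab] locally_finite_emeasure[OF Q]
      by (simp add: ennreal_mult' f0 ennreal_indicator mult.commute)
    then have "has_bochner_integral lborel (\<lambda>t. indicator A t * f t) (measure Q (A \<inter> {0<..}))"
      by (intro has_bochner_integral_nn_integral) (auto simp: f0)
    then show ?thesis by (simp add: has_bochner_integral_iff)
  qed
  have leb: "integrable (lebesgue_on A) f" "(\<integral>t. f t \<partial>lebesgue_on A) = measure Q (A \<inter> {0<..})"
    if A: "A \<in> bounded_borel" for A
  proof -
    have Ab [measurable]: "A \<in> sets borel" using A by (simp add: bounded_borel_def)
    have m: "(\<lambda>t. indicator A t * f t) \<in> borel_measurable lborel" by simp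
    show "integrable (lebesgue_on A) f"
      using fA[OF A] Ab by (simp add: integrable_restrict_space integrable_completion[OF m])
    show "(\<integral>t. f t \<partial>lebesgue_on A) = measure Q (A \<inter> {0<..})"
      using fA[OF A] Ab by (simp add: integral_restrict_space integral_completion[OF m])
  qed
  show ?thesis
  proof (rule that[OF fm f0 leb(1)])
    fix A assume A: "A \<in> bounded_borel"
    have Z: "A \<inter> {0<..} \<in> bounded_borel" "A \<inter> {0} \<in> bounded_borel"
      using A by (auto intro: bounded_borel_subset simp: bounded_borel_def)
    have "emeasure Q A = emeasure Q (A \<inter> {0<..}) + emeasure Q (A \<inter> {0})"
    proof (subst plus_emeasure)
      show "emeasure Q A = emeasure Q (A \<inter> {0<..} \<union> A \<inter> {0})"
        using A by (intro arg_cong[where f = "emeasure Q"]) (auto simp: bounded_borel_def less_le)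
    qed (use Z bounded_borel_half_line in auto)
    then have "measure Q A = measure Q (A \<inter> {0<..}) + measure Q (A \<inter> {0})"
      using Z A by (simp add: locally_finite_emeasure[OF Q] flip: ennreal_plus)
    then show "measure Q A = (\<integral>t. f t \<partial>lebesgue_on A) + (if 0 \<in> A then measure Q {0} else 0)"
      using leb(2)[OF A] by simp
  next
    fix h :: "real \<Rightarrow> ennreal" assume h: "h \<in> borel_measurable borel"
    have "(\<integral>\<^sup>+ t. f t * h t \<partial>lborel) = (\<integral>\<^sup>+ t. h t \<partial>N)"
      using fI[of h] h by (simp add: FN[symmetric] nn_integral_density)
    also have "\<dots> \<le> (\<integral>\<^sup>+ t. h t \<partial>Q)"
      unfolding nnN[OF h] by (intro nn_integral_mono) (auto simp: indicator_def)
    finally show "(\<integral>\<^sup>+ t. f t * h t \<partial>lborel) \<le> (\<integral>\<^sup>+ t. h t \<partial>Q)" .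
  qed
qed

lemma complex_combination_in_L1_plus_delta0:
  assumes Q: "\<And>k. locally_finite (Q k)"
    and null: "\<And>k A. A \<in> null_sets lborel \<Longrightarrow> A \<subseteq> {0<..} \<Longrightarrow> emeasure (Q k) A = 0"
    and \<omega>: "continuous_on {0..} \<omega>" "\<And>t. 0 \<le> t \<Longrightarrow> 0 < \<omega> t"
    and fin: "\<And>k. (\<integral>\<^sup>+ t. ennreal (\<omega> t) \<partial>Q k) < \<infinity>"
  shows "complex_combination Q \<in> L1_plus_delta0 \<omega>"
proof -
  \<comment> \<open>The properties of a density get a name, so that one can be chosen for each \<open>k\<close> at once.\<close>
  define D where "D k f \<longleftrightarrow> f \<in> borel_measurable borel \<and> (\<forall>t. 0 \<le> f t) \<and>
    (\<forall>A\<in>bounded_borel. integrable (lebesgue_on A) f \<and>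
      measure (Q k) A = (\<integral>t. f t \<partial>lebesgue_on A) + (if 0 \<in> A then measure (Q k) {0} else 0)) \<and>
    (\<forall>h :: real \<Rightarrow> ennreal. h \<in> borel_measurable borel \<longrightarrow> (\<integral>\<^sup>+ t. f t * h t \<partial>lborel) \<le> (\<integral>\<^sup>+ t. h t \<partial>Q k))"
    for k and f :: "real \<Rightarrow> real"
  have "\<exists>f. D k f" for k
    by (rule density_plus_atom_decomposition[OF Q[of k] null[of _ k]])
      (auto simp: D_def intro!: exI)
  then obtain f where "\<And>k. D k (f k)" by metis
  then have f: "\<And>k. f k \<in> borel_measurable borel" "\<And>k t. 0 \<le> f k t"
    and fA: "\<And>k A. A \<in> bounded_borel \<Longrightarrow> integrable (lebesgue_on A) (f k)"
    "\<And>k A. A \<in> bounded_borel \<Longrightarrow>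
      measure (Q k) A = (\<integral>t. f k t \<partial>lebesgue_on A) + (if 0 \<in> A then measure (Q k) {0} else 0)"
    and fh: "\<And>k (h :: real \<Rightarrow> ennreal). h \<in> borel_measurable borel \<Longrightarrow> (\<integral>\<^sup>+ t. f k t * h t \<partial>lborel) \<le> (\<integral>\<^sup>+ t. h t \<partial>Q k)"
    unfolding D_def by blast+
  define F where "F t = (\<Sum>k<4. \<i> ^ k * complex_of_real (f k t))" for t
  define c where "c = (\<Sum>k<4. \<i> ^ k * complex_of_real (measure (Q k) {0}))"
  define w where "w t = indicator {0..} t *\<^sub>R \<omega> t" for t
  have Fm: "F \<in> borel_measurable borel" unfolding F_def using f(1) by measurable
  have wm: "w \<in> borel_measurable borel"
    unfolding w_def using \<omega>(1) by (intro borel_measurable_continuous_on_indicator) auto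
  note [measurable] = f(1) wm
  have w0: "0 \<le> w t" for t using \<omega>(2)[of t] by (auto simp: w_def indicator_def)
  have "complex_combination Q A = lebesgue_density F A + c * delta0 A" for A
  proof (cases "A \<in> bounded_borel")
    case True
    have "lebesgue_density F A = (\<Sum>k<4. \<i> ^ k * complex_of_real (\<integral>t. f k t \<partial>lebesgue_on A))"
      using fA(1)[OF True] True by (simp add: lebesgue_density_def F_def[abs_def])
    then show ?thesis
      using True fA(2)[OF True]
      by (simp add: complex_combination_def c_def delta0_def sum.distrib[symmetric] algebra_simps)
  qed (simp add: complex_combination_def lebesgue_density_def delta0_def)
  moreover have "F \<in> weighted_L1 \<omega>"
    unfolding weighted_L1_def
  proof (intro CollectI conjI)
    show "F \<in> borel_measurable (lebesgue_on {0..})"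
      using Fm by (intro measurable_restrict_space1 measurable_completion) simp
    have "(\<integral>\<^sup>+ t. ennreal (cmod (F t) * \<omega> t) \<partial>lebesgue_on {0..})
        = (\<integral>\<^sup>+ t. ennreal (cmod (F t) * w t) \<partial>lborel)"
      by (simp add: nn_integral_restrict_space nn_integral_completion)
        (auto simp: w_def indicator_def intro!: nn_integral_cong)
    also have "\<dots> \<le> (\<integral>\<^sup>+ t. (\<Sum>k<4. ennreal (f k t) * ennreal (w t)) \<partial>lborel)"
    proof (rule nn_integral_mono)
      fix t
      have "cmod (F t) \<le> (\<Sum>k<4. cmod (\<i> ^ k * complex_of_real (f k t)))"
        unfolding F_def by (rule norm_sum)
      also have "\<dots> = (\<Sum>k<4. f k t)" using f(2) by (simp add: norm_mult norm_power)
      finally have "ennreal (cmod (F t) * w t) \<le> ennreal ((\<Sum>k<4. f k t) * w t)"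
        using w0 by (intro ennreal_leI mult_right_mono)
      also have "\<dots> = (\<Sum>k<4. ennreal (f k t) * ennreal (w t))"
        using f(2) w0 by (simp add: sum_distrib_right ennreal_mult' sum_ennreal[symmetric] del: sum_ennreal)
      finally show "ennreal (cmod (F t) * w t) \<le> (\<Sum>k<4. ennreal (f k t) * ennreal (w t))" .
    qed
    also have "\<dots> = (\<Sum>k<4. \<integral>\<^sup>+ t. ennreal (f k t) * ennreal (w t) \<partial>lborel)"
      by (intro nn_integral_sum) measurable
    also have "\<dots> \<le> (\<Sum>k<4. \<integral>\<^sup>+ t. ennreal (w t) \<partial>Q k)"
      by (intro sum_mono fh) measurable
    also have "\<dots> = (\<Sum>k<4. \<integral>\<^sup>+ t. ennreal (\<omega> t) \<partial>Q k)"
      using locally_finite_space[OF Q]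
      by (intro sum.cong refl nn_integral_cong) (simp add: w_def)
    also have "\<dots> < \<infinity>" using fin by simp
    finally show "(\<integral>\<^sup>+ t. ennreal (cmod (F t) * \<omega> t) \<partial>lebesgue_on {0..}) < \<infinity>" .
  qed
  ultimately show ?thesis
    unfolding L1_plus_delta0_def by blast
qed

section \<open>The extended Hardy-Cesaro operator\<close>

text \<open>The product with a Borel measure is formed on Borel sets, so the weight has to be a Borel function. As \<open>\<psi>\<close>
  enters only through integrals in \<open>t\<close>, a change on a Lebesgue null set is harmless.\<close>

lemma obtain_borel_version:
  fixes \<psi> :: "real \<Rightarrow> real"
  assumes \<psi>: "\<psi> \<in> borel_measurable (lebesgue_on {0..1})" and nonneg: "\<And>t. t \<in> {0..1} \<Longrightarrow> 0 \<le> \<psi> t"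
  obtains \<phi> where "\<phi> \<in> borel_measurable borel" "\<And>t. 0 \<le> \<phi> t"
    "AE t in lebesgue_on {0..1}. \<psi> t = \<phi> t"
proof -
  have "(\<lambda>t. indicator {0..1} t *\<^sub>R \<psi> t) \<in> borel_measurable lebesgue"
    using \<psi> by (subst (asm) borel_measurable_restrict_space_iff) auto
  then obtain \<phi> where \<phi>: "\<phi> \<in> borel_measurable lborel"
    "AE t in lborel. indicator {0..1} t *\<^sub>R \<psi> t = \<phi> t"
    using completion_ex_borel_measurable_real by blast
  have "AE t in lebesgue. t \<in> {0..1} \<longrightarrow> \<psi> t = max 0 (\<phi> t)"
    using AE_completion[OF \<phi>(2)]
  proof eventually_elim
    case (elim t)
    then show ?case using nonneg[of t] by auto
  qed
  then have "AE t in lebesgue_on {0..1}. \<psi> t = max 0 (\<phi> t)"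
    by (simp add: AE_restrict_space_iff)
  then show ?thesis
    using that[of "\<lambda>t. max 0 (\<phi> t)"] \<phi>(1) by simp
qed

lemma nn_integral_cesaro_weight_version:
  assumes \<phi>: "\<phi> \<in> borel_measurable borel" "AE t in lebesgue_on {0..1}. \<psi> t = \<phi> t"
    and h: "h \<in> borel_measurable borel"
  shows "(\<integral>\<^sup>+ t. h t \<partial>cesaro_weight \<phi>) = (\<integral>\<^sup>+ t. ennreal (\<psi> t / t) * h t \<partial>lebesgue_on {0..1})"
proof -
  have "(\<integral>\<^sup>+ t. ennreal (\<psi> t / t) * h t \<partial>lebesgue_on {0..1})
      = (\<integral>\<^sup>+ t. ennreal (\<phi> t / t) * h t \<partial>lebesgue_on {0..1})"
    using \<phi>(2) by (intro nn_integral_cong_AE) auto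
  also have "\<dots> = (\<integral>\<^sup>+ t. ennreal (\<phi> t / t) * h t * indicator {0..1} t \<partial>lborel)"
    by (simp add: nn_integral_restrict_space nn_integral_completion)
  also have "\<dots> = (\<integral>\<^sup>+ t. ennreal (\<phi> t / t) * h t * indicator {0<..1} t \<partial>lborel)"
    by (intro nn_integral_cong) (auto simp: indicator_def)
  finally show ?thesis
    by (simp add: nn_integral_cesaro_weight[OF \<phi>(1) h])
qed

text \<open>At \<open>t = 0\<close> the factor \<open>\<psi> t / t\<close> is \<open>0\<close> by convention, so passing from \<open>[0,1]\<close> to \<open>(0,1]\<close>
  changes nothing.\<close>

lemma hardy_cesaro_V_eq_integral_cesaro_weight:
  assumes \<phi>: "\<phi> \<in> borel_measurable borel" "\<And>t. 0 \<le> \<phi> t" "AE t in lebesgue_on {0..1}. \<psi> t = \<phi> t"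
    and \<psi>: "\<psi> \<in> borel_measurable (lebesgue_on {0..1})"
    and g: "continuous_on {0..} g" and x: "0 \<le> x"
  shows "hardy_cesaro_V \<psi> g x = (\<integral>t. g (x / t) \<partial>cesaro_weight \<phi>)"
proof -
  define G where "G y = indicator {0..} y *\<^sub>R g y" for y
  note [measurable] = \<phi>(1)
  have [measurable]: "G \<in> borel_measurable borel"
    unfolding G_def using g by (intro borel_measurable_continuous_on_indicator) auto
  have Gx [measurable]: "(\<lambda>t. G (x / t)) \<in> borel_measurable borel" by measurable
  have leb: "f \<in> borel_measurable (lebesgue_on {0..1})" if "f \<in> borel_measurable borel"
    for f :: "real \<Rightarrow> 'b::topological_space"
    using that by (intro measurable_restrict_space1 measurable_completion) simp
  have "hardy_cesaro_V \<psi> g x = (\<integral>t. G (x / t) * complex_of_real (\<psi> t / t) \<partial>lebesgue_on {0..1})"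
    unfolding hardy_cesaro_V_def
    using x by (intro Bochner_Integration.integral_cong) (auto simp: G_def)
  also have "\<dots> = (\<integral>t. G (x / t) * complex_of_real (\<phi> t / t) \<partial>lebesgue_on {0..1})"
  proof (rule integral_cong_AE)
    have id: "(\<lambda>t. t) \<in> borel_measurable (lebesgue_on {0..1::real})" by (rule leb) simp
    note [measurable] = leb[OF Gx] borel_measurable_divide[OF \<psi> id]
    show "(\<lambda>t. G (x / t) * complex_of_real (\<psi> t / t)) \<in> borel_measurable (lebesgue_on {0..1})"
      by measurable
    show "(\<lambda>t. G (x / t) * complex_of_real (\<phi> t / t)) \<in> borel_measurable (lebesgue_on {0..1})"
      by (rule leb) measurable
  qed (use \<phi>(3) in auto)
  also have "\<dots> = (\<integral>t. indicator {0..1} t *\<^sub>R (G (x / t) * complex_of_real (\<phi> t / t)) \<partial>lborel)"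
    by (simp add: integral_restrict_space integral_completion)
  also have "\<dots> = (\<integral>t. indicator {0<..1} t *\<^sub>R ((\<phi> t / t) *\<^sub>R G (x / t)) \<partial>lborel)"
    by (intro Bochner_Integration.integral_cong) (auto simp: indicator_def scaleR_conv_of_real)
  also have "\<dots> = (\<integral>t. (\<phi> t / t) *\<^sub>R G (x / t) \<partial>restrict_space lborel {0<..1})"
    by (simp add: integral_restrict_space)
  also have "\<dots> = (\<integral>t. G (x / t) \<partial>cesaro_weight \<phi>)"
    unfolding cesaro_weight_def
  proof (rule integral_density[symmetric])
    show "AE t in restrict_space lborel {0<..1}. 0 \<le> \<phi> t / t"
      using \<phi>(2) by (intro AE_I2) (auto simp: space_restrict_space)
  qed (auto intro!: measurable_restrict_space1)
  also have "\<dots> = (\<integral>t. g (x / t) \<partial>cesaro_weight \<phi>)"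
    using x by (intro Bochner_Integration.integral_cong) (auto simp: G_def)
  finally show ?thesis .
qed

lemma weighted_C0_bounded:
  assumes \<omega>: "continuous_on {0..} \<omega>" "\<And>t. 0 \<le> t \<Longrightarrow> 0 < \<omega> t" and g: "g \<in> weighted_C0 \<omega>"
  obtains K where "0 \<le> K" "\<And>t. 0 \<le> t \<Longrightarrow> cmod (g t) \<le> K * \<omega> t"
proof -
  let ?q = "\<lambda>t. g t / complex_of_real (\<omega> t)"
  have gc: "continuous_on {0..} g" and lim: "(?q \<longlongrightarrow> 0) at_top"
    using g by (auto simp: weighted_C0_def)
  have "\<forall>\<^sub>F t in at_top. dist (?q t) 0 < 1" using lim by (rule tendstoD) simp
  then obtain N where N: "\<And>t. N \<le> t \<Longrightarrow> cmod (?q t) < 1"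
    by (auto simp: eventually_at_top_linorder)
  have "continuous_on {0..N} ?q"
  proof (intro continuous_on_divide continuous_on_of_real)
    show "continuous_on {0..N} g" by (rule continuous_on_subset[OF gc]) auto
    show "continuous_on {0..N} \<omega>" by (rule continuous_on_subset[OF \<omega>(1)]) auto
  qed (use \<omega>(2) in force)
  then have "bounded (?q ` {0..N})"
    by (intro compact_imp_bounded compact_continuous_image) auto
  then obtain B where "\<forall>z \<in> ?q ` {0..N}. norm z \<le> B"
    unfolding bounded_iff by blast
  then have B: "\<And>t. t \<in> {0..N} \<Longrightarrow> cmod (?q t) \<le> B" by blast
  have "cmod (g t) \<le> max B 1 * \<omega> t" if "0 \<le> t" for t
  proof -
    have "cmod (?q t) \<le> max B 1" using N[of t] B[of t] that by fastforce
    then show ?thesis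
      using \<omega>(2)[OF that] by (simp add: norm_divide pos_divide_le_eq)
  qed
  then show ?thesis using that[of "max B 1"] by auto
qed

lemma hardy_cesaro_ext_eqI:
  assumes \<omega>: "continuous_on {0..} \<omega>2" "\<And>t. 0 \<le> t \<Longrightarrow> 0 < \<omega>2 t"
    and \<nu>: "\<nu> \<in> weighted_measures \<omega>2"
    and eq: "\<And>g. g \<in> weighted_C0 \<omega>2 \<Longrightarrow>
      complex_measure_integral g \<nu> = complex_measure_integral (hardy_cesaro_V \<psi> g) \<mu>"
  shows "hardy_cesaro_ext \<psi> \<omega>2 \<mu> = \<nu>"
  unfolding hardy_cesaro_ext_def
proof (rule the_equality)
  fix \<nu>' assume \<nu>': "\<nu>' \<in> weighted_measures \<omega>2 \<and>
    (\<forall>g \<in> weighted_C0 \<omega>2. complex_measure_integral g \<nu>' = complex_measure_integral (hardy_cesaro_V \<psi> g) \<mu>)"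
  show "\<nu>' = \<nu>"
  proof (rule complex_measure_integral_determines[OF \<omega>])
    show "\<nu>' \<in> weighted_measures \<omega>2" using \<nu>' by blast
    show "complex_measure_integral g \<nu>' = complex_measure_integral g \<nu>" if "g \<in> weighted_C0 \<omega>2" for g
      using \<nu>' eq[OF that] that by simp
  qed (use \<nu> in auto)
qed (use \<nu> eq in simp)

theorem proposition3p4:
  fixes \<psi> \<omega>1 \<omega>2 :: "real \<Rightarrow> real" and C :: real
  assumes "\<psi> \<in> borel_measurable (lebesgue_on {0..1})"
    and "\<And>t. t \<in> {0..1} \<Longrightarrow> 0 \<le> \<psi> t"
    and "continuous_on {0..} \<omega>1" and "\<And>t. 0 \<le> t \<Longrightarrow> 0 < \<omega>1 t"
    and "continuous_on {0..} \<omega>2" and "\<And>t. 0 \<le> t \<Longrightarrow> 0 < \<omega>2 t"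
    and "\<And>s. 0 \<le> s \<Longrightarrow>
      (\<integral>\<^sup>+ t. ennreal (\<omega>2 (s / t) * (\<psi> t / t)) \<partial>lebesgue_on {0..1}) \<le> ennreal (C * \<omega>1 s)"
  shows "hardy_cesaro_ext \<psi> \<omega>2 ` weighted_measures \<omega>1 \<subseteq> L1_plus_delta0 \<omega>2"
proof (rule image_subsetI)
  fix \<mu> assume \<mu>: "\<mu> \<in> weighted_measures \<omega>1"
  obtain \<phi> where \<phi>: "\<phi> \<in> borel_measurable borel" "\<And>t. 0 \<le> \<phi> t"
    "AE t in lebesgue_on {0..1}. \<psi> t = \<phi> t"
    using obtain_borel_version[of \<psi>] assms(1,2) by blast
  obtain P where P: "\<And>k. locally_finite (P k)" "\<And>k. (\<integral>\<^sup>+ s. ennreal (\<omega>1 s) \<partial>P k) < \<infinity>"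
    and \<mu>P: "\<And>g. complex_measure_integral g \<mu> = (\<Sum>k<4. \<i> ^ k * (\<integral>s. g s \<partial>P k))"
    using weighted_measures_eq_complex_combination[OF \<mu> assms(3,4)] by metis
  \<comment> \<open>The weight is cut off on the negative half-line, where nothing is known about it, to make it
    Borel on the line.\<close>
  define w where "w y = indicator {0..} y *\<^sub>R \<omega>2 y" for y
  have wm [measurable]: "w \<in> borel_measurable borel"
    unfolding w_def using assms(5) by (intro borel_measurable_continuous_on_indicator) auto
  have key: "(\<integral>\<^sup>+ t. ennreal (w (s / t)) \<partial>cesaro_weight \<phi>) \<le> ennreal (C * \<omega>1 s)" if s: "0 \<le> s" for s
  proof -
    have "(\<lambda>t. ennreal (w (s / t))) \<in> borel_measurable borel" by measurable
    then have "(\<integral>\<^sup>+ t. ennreal (w (s / t)) \<partial>cesaro_weight \<phi>)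
        = (\<integral>\<^sup>+ t. ennreal (\<psi> t / t) * ennreal (w (s / t)) \<partial>lebesgue_on {0..1})"
      by (rule nn_integral_cesaro_weight_version[OF \<phi>(1,3)])
    also have "\<dots> = (\<integral>\<^sup>+ t. ennreal (\<omega>2 (s / t) * (\<psi> t / t)) \<partial>lebesgue_on {0..1})"
    proof (rule nn_integral_cong)
      fix t :: real assume "t \<in> space (lebesgue_on {0..1})"
      then have t: "t \<in> {0..1}" by simp
      then have "0 \<le> s / t" using s by simp
      then have "0 < \<omega>2 (s / t)" "w (s / t) = \<omega>2 (s / t)" using assms(6) by (auto simp: w_def)
      moreover have "0 \<le> \<psi> t / t" using assms(2)[OF t] t by simp
      ultimately show "ennreal (\<psi> t / t) * ennreal (w (s / t)) = ennreal (\<omega>2 (s / t) * (\<psi> t / t))"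
        by (simp add: ennreal_mult[symmetric] mult.commute)
    qed
    also have "\<dots> \<le> ennreal (C * \<omega>1 s)" by (rule assms(7)[OF s])
    finally show ?thesis .
  qed
  have D: "finite_measure (cesaro_weight \<phi>)"
  proof
    \<comment> \<open>The hypothesis at \<open>s = 0\<close> reads \<open>\<omega>2(0) \<integral> \<psi>(t)/t dt \<le> C \<omega>1(0)\<close>.\<close>
    have "ennreal (\<omega>2 0) * emeasure (cesaro_weight \<phi>) (space (cesaro_weight \<phi>))
        = (\<integral>\<^sup>+ t. ennreal (w (0 / t)) \<partial>cesaro_weight \<phi>)"
      by (simp add: w_def)
    also have "\<dots> < \<infinity>" using key[of 0] by (simp add: le_less_trans)
    finally show "emeasure (cesaro_weight \<phi>) (space (cesaro_weight \<phi>)) \<noteq> \<infinity>"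
      using assms(6)[of 0] by (auto simp: ennreal_mult_less_top)
  qed
  define Q where "Q k = cesaro_image \<phi> (P k)" for k
  have sQ: "sets (Q k) = sets half_line" for k by (simp add: Q_def)
  have finQ: "(\<integral>\<^sup>+ y. ennreal (\<omega>2 y) \<partial>Q k) < \<infinity>" for k
  proof -
    have "(\<lambda>y. ennreal (\<omega>2 y)) \<in> borel_measurable half_line"
      using borel_measurable_continuous_on_restrict[OF assms(5)] by measurable
    then have "(\<integral>\<^sup>+ y. ennreal (\<omega>2 y) \<partial>Q k)
        = (\<integral>\<^sup>+ s. \<integral>\<^sup>+ t. ennreal (\<omega>2 (s / t)) \<partial>cesaro_weight \<phi> \<partial>P k)"
      unfolding Q_def by (rule nn_integral_cesaro_image[OF locally_finite_sets[OF P(1)] D])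
    also have "\<dots> \<le> (\<integral>\<^sup>+ s. ennreal \<bar>C\<bar> * ennreal (\<omega>1 s) \<partial>P k)"
    proof (rule nn_integral_mono)
      fix s assume "s \<in> space (P k)"
      then have s: "0 \<le> s" using locally_finite_space[OF P(1)] by auto
      have "(\<integral>\<^sup>+ t. ennreal (\<omega>2 (s / t)) \<partial>cesaro_weight \<phi>) = (\<integral>\<^sup>+ t. ennreal (w (s / t)) \<partial>cesaro_weight \<phi>)"
        using s by (intro nn_integral_cong) (auto simp: w_def)
      also have "\<dots> \<le> ennreal (C * \<omega>1 s)" by (rule key[OF s])
      also have "\<dots> \<le> ennreal (\<bar>C\<bar> * \<omega>1 s)"
        using assms(4)[OF s] by (intro ennreal_leI mult_right_mono) auto
      finally show "(\<integral>\<^sup>+ t. ennreal (\<omega>2 (s / t)) \<partial>cesaro_weight \<phi>) \<le> ennreal \<bar>C\<bar> * ennreal (\<omega>1 s)"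
        by (simp add: ennreal_mult')
    qed
    also have "\<dots> = ennreal \<bar>C\<bar> * (\<integral>\<^sup>+ s. ennreal (\<omega>1 s) \<partial>P k)"
    proof (rule nn_integral_cmult)
      have "(\<lambda>s. ennreal (\<omega>1 s)) \<in> borel_measurable half_line"
        using borel_measurable_continuous_on_restrict[OF assms(3)] by measurable
      then show "(\<lambda>s. ennreal (\<omega>1 s)) \<in> borel_measurable (P k)"
        by (simp add: measurable_cong_sets[OF locally_finite_sets[OF P(1)] refl])
    qed
    also have "\<dots> < \<infinity>" using P(2)[of k] by (simp add: ennreal_mult_less_top)
    finally show ?thesis .
  qed
  have Q: "locally_finite (Q k)" for k
    using sQ assms(5,6) finQ by (rule locally_finite_if_weight_integrable)
  have "hardy_cesaro_ext \<psi> \<omega>2 \<mu> = complex_combination Q"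
  proof (rule hardy_cesaro_ext_eqI[OF assms(5,6)])
    show "complex_combination Q \<in> weighted_measures \<omega>2"
      using Q assms(5) finQ by (rule complex_combination_in_weighted_measures)
    fix g assume g: "g \<in> weighted_C0 \<omega>2"
    then have gc: "continuous_on {0..} g" by (simp add: weighted_C0_def)
    obtain K where K: "0 \<le> K" "\<And>t. 0 \<le> t \<Longrightarrow> cmod (g t) \<le> K * \<omega>2 t"
      using weighted_C0_bounded[OF assms(5,6) g] by blast
    have int: "integrable (Q k) g" for k
      unfolding integrable_iff_bounded
    proof
      have sp: "space (Q k) = {0..}" by (rule locally_finite_space[OF Q])
      show "g \<in> borel_measurable (Q k)"
        using borel_measurable_continuous_on_restrict[OF gc] by (simp add: measurable_cong_sets[OF sQ refl])
      have wQ: "(\<lambda>y. ennreal (\<omega>2 y)) \<in> borel_measurable (Q k)"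
        using borel_measurable_continuous_on_restrict[OF assms(5)]
        by (simp add: measurable_cong_sets[OF sQ refl])
      have "(\<integral>\<^sup>+ y. ennreal (cmod (g y)) \<partial>Q k) \<le> (\<integral>\<^sup>+ y. ennreal K * ennreal (\<omega>2 y) \<partial>Q k)"
        using K sp by (intro nn_integral_mono) (simp add: ennreal_mult'[symmetric] ennreal_leI)
      also have "\<dots> = ennreal K * (\<integral>\<^sup>+ y. ennreal (\<omega>2 y) \<partial>Q k)"
        using wQ by (rule nn_integral_cmult)
      also have "\<dots> < \<infinity>" using finQ[of k] by (simp add: ennreal_mult_less_top)
      finally show "(\<integral>\<^sup>+ y. ennreal (cmod (g y)) \<partial>Q k) < \<infinity>" .
    qed
    have "(\<integral>y. g y \<partial>Q k) = (\<integral>s. hardy_cesaro_V \<psi> g s \<partial>P k)" for k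
    proof -
      have "(\<integral>y. g y \<partial>Q k) = (\<integral>s. \<integral>t. g (s / t) \<partial>cesaro_weight \<phi> \<partial>P k)"
        using int unfolding Q_def by (rule integral_cesaro_image[OF P(1) D])
      also have "\<dots> = (\<integral>s. hardy_cesaro_V \<psi> g s \<partial>P k)"
        using locally_finite_space[OF P(1)]
        by (intro Bochner_Integration.integral_cong refl
            hardy_cesaro_V_eq_integral_cesaro_weight[OF \<phi> assms(1) gc, symmetric]) auto
      finally show ?thesis .
    qed
    then show "complex_measure_integral g (complex_combination Q)
        = complex_measure_integral (hardy_cesaro_V \<psi> g) \<mu>"
      by (simp add: complex_measure_integral_complex_combination[OF Q int] \<mu>P)
  qed
  also have "complex_combination Q \<in> L1_plus_delta0 \<omega>2"
    using Q _ assms(5,6) finQ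
  proof (rule complex_combination_in_L1_plus_delta0)
    show "emeasure (Q k) A = 0" if "A \<in> null_sets lborel" "A \<subseteq> {0<..}" for k A
      unfolding Q_def using that by (rule null_set_cesaro_image[OF locally_finite_sets[OF P(1)] D \<phi>(1)])
  qed
  finally show "hardy_cesaro_ext \<psi> \<omega>2 \<mu> \<in> L1_plus_delta0 \<omega>2" .
qed

end
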